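(* Algorithm LPGA (defined in the context) is well defined, i.e. all the probabilities and conditional distributions it prescribes are valid (in particular $0\le w_{j,t}\le 1$ for all $j\in[n]$, $t\in[T]$, almost surely), and its realized net revenue $R^{\mathrm{ALG}}$ satisfies $$\mathbb E[R^{\mathrm{ALG}}]\ \ge\ \Big(1-\frac1e\Big)\mathrm{OPT}.$$
   Context: Notation: $[m]=\{1,\dots,m\}$, $[m]_0=\{0,\dots,m\}$, $\mathbb Z_+=\{0,1,\dots\}$, $(x)^+=\max\{x,0\}$. Model (general DSR). There are $n$ services with revenues $r_j\ge0$ and $T$ periods. $Q_j(t)\in\mathbb Z_+$ is the queue length of service $j$ at the beginning of period $t$; $Q_j(1)=0$. In period $t\in[T]$ a customer arrives with probability $\lambda_t\in(0,1]$, independently across periods; upon an arrival the platform may recommend one service or none; if $j$ is recommended with $Q_j(t)=q$ the customer joins service $j$ with probability $a_j(q)$, where $a_j:\mathbb Z_+\to[0,1]$ is an arbitrary nonincreasing function, and otherwise leaves. $A_{j,t}\in\{0,1\}$ indicates a join of service $j$ in period $t$, $Q_j^+(t)=Q_j(t)+A_{j,t}$, and $Q_j(t+1)=(Q_j^+(t)-B_{j,t})^+$, where the service capacities $B_{j,t}$ are mutually independent, independent of arrivals, customer choices and platform randomness, with $\mathbb P(B_{j,t}=b)=\xi_{j,b}$, $b\in\mathbb Z_+$, $\xi_{j,b}\ge0$, $\sum_b\xi_{j,b}=1$. Service is first-in-first-out. The platform observes queue lengths and arrivals/joins but not $B_{j,t}$. Policies may be randomized and history dependent; $\mathcal R(\pi)=\mathbb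 E_\pi[\sum_{t=1}^T\sum_j r_jA_{j,t}-\sum_j r_jQ_j(T+1)]$ is the expected net revenue and $\mathrm{OPT}=\sup_\pi\mathcal R(\pi)$ over all policies. The realized net revenue is the quantity inside this expectation. LP. Let $\bar a_{j,t}(q)=\lambda_ta_j(q)$, $K_j(q,q')=\mathbb P((q-B_{j,t})^+=q')$ and $\kappa_{j,q,t}=\mathbb P(\sum_{\tau=t}^TB_{j,\tau}\ge q+1)$. The LP (MOLP) is: maximize $\sum_{t=1}^T\sum_{j=1}^n\sum_{q=0}^{t-1}r_j\kappa_{j,q,t}\bar a_{j,t}(q)x_{j,q,t}$ over $x,y\ge0$ subject to, for all $j\in[n]$, $t\in[T]$: (1) $x_{j,q,t}\le y_{j,q,t}$ for $q\in[t-1]_0$; (2) $\sum_{j=1}^n\sum_{q=0}^{t-1}x_{j,q,t}\le1$; (3) $y_{j,q',t+1}=\sum_{q=0}^{t-1}[(y_{j,q,t}-\bar a_{j,t}(q)x_{j,q,t})K_j(q,q')+\bar a_{j,t}(q)x_{j,q,t}K_j(q+1,q')]$ for $q'\in[t]_0$; (4) $y_{j,0,1}=1$; (5) $y_{j,q,1}=0$ for $q\ge1$. Let $(x^*,y^* )$ be an optimal solution, and let $\theta_{j,q,t}=x^*_{j,q,t}/y^*_{j,q,t}$ if $y^*_{j,q,t}>0$ and $\theta_{j,q,t}=0$ otherwise. Algorithm LPGA. It maintains virtual queues $\widehat Q_j(t)$, $\widehat Q_j(1)=0$, alongside the actual queues $Q_j(t)$. In period $t$ set $w_{j,t}=\theta_{j,\widehat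 Q_j(t),t}\,\bar a_{j,t}(\widehat Q_j(t))/\bar a_{j,t}(Q_j(t))$ if $\bar a_{j,t}(Q_j(t))>0$, and $w_{j,t}=0$ otherwise. Step 1: independently for each $j$ draw $I_{j,t}\sim\mathrm{Bernoulli}(w_{j,t})$; let $S_t=\{j:I_{j,t}=1\}$. Step 2: if $S_t=\emptyset$ set $J_t=0$; otherwise choose $J_t\in\arg\max_{j\in S_t}r_j\bar a_{j,t}(Q_j(t))\kappa_{j,Q_j(t),t}$, ties broken by a fixed rule. Step 3: if a customer arrives and $J_t=j\in[n]$, recommend service $j$; otherwise make no recommendation. Step 4: the joins $A_{j,t}$ (zero for $j\ne J_t$) and then $Q(t+1)$ are realized and observed. Step 5: (a) if $J_t=j\in[n]$ set $\widehat A_{j,t}=A_{j,t}$; for $k\in S_t\setminus\{J_t\}$ independently sample $\widehat A_{k,t}\sim\mathrm{Bernoulli}(\bar a_{k,t}(Q_k(t)))$; for $k\notin S_t$ set $\widehat A_{k,t}=0$. (b) For each $j$: if $Q_j(t+1)>0$ set $\widehat B_{j,t}=Q_j^+(t)-Q_j(t+1)$; if $Q_j(t+1)=0$ sample $\widehat B_{j,t}$ (independently) with $\mathbb P(\widehat B_{j,t}=b\mid Q_j^+(t),Q_j(t+1)=0)=\xi_{j,b}/\sum_{b'\ge Q_j^+(t)}\xi_{j,b'}$ for $b\ge Q_j^+(t)$ and probability $0$ for $b<Q_j^+(t)$. (c) Set $\widehat Q_j(t+1)=(\widehat Q_j(t)+\widehat A_{j,t}-\widehat B_{j,t})^+$.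 *)

theory Defs
  imports "HOL-Probability.Probability" "HOL-Library.Monad_Syntax"
begin

text \<open>
  Services are \<open>1, \<dots>, n\<close> and periods \<open>1, \<dots>, T\<close>; vectors indexed by services are functions on
  \<open>nat\<close> that are relevant only on \<open>{1..n}\<close>. A trajectory is the chronological list of the
  periods played so far, so the period following \<open>h\<close> is number \<open>length h + 1\<close>.
\<close>

record period =
  queue :: "nat \<Rightarrow> nat"
  arrived :: bool
  recommended :: "nat option"
  joins :: "nat \<Rightarrow> nat"
  next_queue :: "nat \<Rightarrow> nat"

text \<open>
  The field \<open>signal\<close> is private randomness of the platform. It stays in the history, so that a policy
  may randomize and correlate its decisions over time by means of an internal memory.
\<close>

record policy_period = period +
  signal :: nat

record lpga_period = period +
  vqueue :: "nat \<Rightarrow> nat"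
  sampled :: "nat set"
  selected :: "nat option"
  vjoins :: "nat \<Rightarrow> nat"
  vservice :: "nat \<Rightarrow> nat"
  next_vqueue :: "nat \<Rightarrow> nat"

type_synonym policy = "policy_period list \<Rightarrow> bool \<Rightarrow> (nat \<times> nat option) pmf"

definition queue_after :: "'a period_scheme list \<Rightarrow> nat \<Rightarrow> nat" where
  "queue_after h = (if h = [] then (\<lambda>_. 0) else next_queue (last h))"

definition vqueue_after :: "lpga_period list \<Rightarrow> nat \<Rightarrow> nat" where
  "vqueue_after h = (if h = [] then (\<lambda>_. 0) else next_vqueue (last h))"

definition theta :: "(nat \<Rightarrow> nat \<Rightarrow> nat \<Rightarrow> real) \<Rightarrow> (nat \<Rightarrow> nat \<Rightarrow> nat \<Rightarrow> real)
    \<Rightarrow> nat \<Rightarrow> nat \<Rightarrow> nat \<Rightarrow> real" where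
  "theta x y j q t = (if y j q t > 0 then x j q t / y j q t else 0)"

text \<open>
  \<open>xi j\<close> is the law of the capacity of service \<open>j\<close> in one period, i.e.\ \<open>pmf (xi j) b\<close> is the
  probability of capacity \<open>b\<close>. Truncated subtraction on \<open>nat\<close> renders the positive part throughout.
\<close>

locale dsr =
  fixes n T :: nat
    and r lam :: "nat \<Rightarrow> real"
    and a :: "nat \<Rightarrow> nat \<Rightarrow> real"
    and xi :: "nat \<Rightarrow> nat pmf"
  assumes revenue_nonneg: "\<And>j. j \<in> {1..n} \<Longrightarrow> 0 \<le> r j"
    and arrival_prob: "\<And>t. t \<in> {1..T} \<Longrightarrow> 0 < lam t \<and> lam t \<le> 1"
    and join_prob: "\<And>j q. j \<in> {1..n} \<Longrightarrow> 0 \<le> a j q \<and> a j q \<le> 1"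
    and join_antimono: "\<And>j. j \<in> {1..n} \<Longrightarrow> antimono (a j)"
begin

definition join_pmf :: "(nat \<Rightarrow> nat) \<Rightarrow> nat option \<Rightarrow> (nat \<Rightarrow> nat) pmf" where
  "join_pmf Q rec = (case rec of
      None \<Rightarrow> return_pmf (\<lambda>_. 0)
    | Some j \<Rightarrow> map_pmf (\<lambda>b. (\<lambda>_. 0)(j := of_bool b)) (bernoulli_pmf (a j (Q j))))"

definition serve_pmf :: "(nat \<Rightarrow> nat) \<Rightarrow> (nat \<Rightarrow> nat) pmf" where
  "serve_pmf Qp = map_pmf (\<lambda>B j. Qp j - B j) (Pi_pmf {1..n} 0 xi)"

definition net_revenue :: "'a period_scheme list \<Rightarrow> real" where
  "net_revenue h = (\<Sum>p\<leftarrow>h. \<Sum>j=1..n. r j * real (joins p j))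
                   - (\<Sum>j=1..n. r j * real (queue_after h j))"

definition policies :: "policy set" where
  "policies = {\<pi>. \<forall>h arr. \<forall>(s, rec) \<in> set_pmf (\<pi> h arr).
      rec = None \<or> (arr \<and> rec \<in> Some ` {1..n})}"

definition policy_step :: "policy \<Rightarrow> policy_period list \<Rightarrow> policy_period pmf" where
  "policy_step \<pi> h = do {
     let Q = queue_after h;
     arr \<leftarrow> bernoulli_pmf (lam (length h + 1));
     (s, rec) \<leftarrow> \<pi> h arr;
     A \<leftarrow> join_pmf Q rec;
     Q' \<leftarrow> serve_pmf (\<lambda>j. Q j + A j);
     return_pmf \<lparr>queue = Q, arrived = arr, recommended = rec, joins = A, next_queue = Q',
                 signal = s\<rparr>
   }"

primrec policy_run :: "policy \<Rightarrow> nat \<Rightarrow> policy_period list pmf" where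
  "policy_run \<pi> 0 = return_pmf []"
| "policy_run \<pi> (Suc k) = do {
     h \<leftarrow> policy_run \<pi> k;
     p \<leftarrow> policy_step \<pi> h;
     return_pmf (h @ [p])
   }"

definition policy_revenue :: "policy \<Rightarrow> real" where
  "policy_revenue \<pi> = measure_pmf.expectation (policy_run \<pi> T) net_revenue"

definition OPT :: real where
  "OPT = (SUP \<pi>\<in>policies. policy_revenue \<pi>)"

text \<open>The supremum in \<open>OPT\<close> ranges over a nonempty set that is bounded above.\<close>

lemma policy_run_support:
  assumes "h \<in> set_pmf (policy_run \<pi> k)"
  shows "length h = k \<and> (\<forall>p\<in>set h. \<forall>j. joins p j \<le> 1)"
  using assms
proof (induction k arbitrary: h)
  case 0
  then show ?case by simp
next
  case (Suc k)
  then obtain h' p where h': "h' \<in> set_pmf (policy_run \<pi> k)" "p \<in> set_pmf (policy_step \<pi> h')"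
    and h: "h = h' @ [p]"
    by auto
  have "joins p j \<le> 1" for j
    using h'(2) by (auto simp: policy_step_def join_pmf_def Let_def split: option.splits)
  then show ?case using Suc.IH[OF h'(1)] h by auto
qed

lemma policies_nonempty: "policies \<noteq> {}"
proof -
  have "(\<lambda>_ _. return_pmf (0, None)) \<in> policies" by (auto simp: policies_def)
  then show ?thesis by blast
qed

lemma bdd_above_policy_revenue: "bdd_above (policy_revenue ` policies)"
proof (rule bdd_aboveI2)
  fix \<pi>
  let ?C = "real T * (\<Sum>j=1..n. r j)"
  have nonneg: "0 \<le> (\<Sum>j=1..n. r j)" by (intro sum_nonneg revenue_nonneg)
  have bound: "net_revenue h \<le> ?C" if "h \<in> set_pmf (policy_run \<pi> T)" for h
  proof -
    have "(\<Sum>p\<leftarrow>h. \<Sum>j=1..n. r j * real (joins p j)) \<le> (\<Sum>p\<leftarrow>h. \<Sum>j=1..n. r j)"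
      using policy_run_support[OF that] revenue_nonneg
      by (intro sum_list_mono sum_mono) (auto intro!: mult_left_le)
    moreover have "0 \<le> (\<Sum>j=1..n. r j * real (queue_after h j))"
      by (intro sum_nonneg mult_nonneg_nonneg revenue_nonneg) auto
    ultimately show ?thesis
      using policy_run_support[OF that] by (simp add: net_revenue_def sum_list_triv)
  qed
  show "policy_revenue \<pi> \<le> ?C"
  proof (cases "integrable (measure_pmf (policy_run \<pi> T)) net_revenue")
    case True
    then show ?thesis unfolding policy_revenue_def
      using bound by (intro measure_pmf.integral_le_const) (simp_all add: AE_measure_pmf_iff)
  next
    case False
    then show ?thesis using nonneg by (simp add: policy_revenue_def not_integrable_integral_eq)
  qed
qed

definition abar :: "nat \<Rightarrow> nat \<Rightarrow> nat \<Rightarrow> real" where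
  "abar j t q = lam t * a j q"

definition K :: "nat \<Rightarrow> nat \<Rightarrow> nat \<Rightarrow> real" where
  "K j q q' = measure_pmf.prob (xi j) {b. q - b = q'}"

definition kappa :: "nat \<Rightarrow> nat \<Rightarrow> nat \<Rightarrow> real" where
  "kappa j q t = measure_pmf.prob (Pi_pmf {t..T} 0 (\<lambda>_. xi j)) {B. (\<Sum>\<tau>=t..T. B \<tau>) \<ge> q + 1}"

definition molp_objective :: "(nat \<Rightarrow> nat \<Rightarrow> nat \<Rightarrow> real) \<Rightarrow> real" where
  "molp_objective x =
     (\<Sum>t=1..T. \<Sum>j=1..n. \<Sum>q=0..t-1. r j * kappa j q t * abar j t q * x j q t)"

definition molp_feasible ::
    "(nat \<Rightarrow> nat \<Rightarrow> nat \<Rightarrow> real) \<Rightarrow> (nat \<Rightarrow> nat \<Rightarrow> nat \<Rightarrow> real) \<Rightarrow> bool" where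
  "molp_feasible x y \<longleftrightarrow>
     (\<forall>j\<in>{1..n}. \<forall>t\<in>{1..T}. \<forall>q\<in>{0..t-1}. 0 \<le> x j q t) \<and>
     (\<forall>j\<in>{1..n}. \<forall>t\<in>{1..T+1}. \<forall>q\<in>{0..t-1}. 0 \<le> y j q t) \<and>
     (\<forall>j\<in>{1..n}. \<forall>t\<in>{1..T}. \<forall>q\<in>{0..t-1}. x j q t \<le> y j q t) \<and>
     (\<forall>t\<in>{1..T}. (\<Sum>j=1..n. \<Sum>q=0..t-1. x j q t) \<le> 1) \<and>
     (\<forall>j\<in>{1..n}. \<forall>t\<in>{1..T}. \<forall>q'\<in>{0..t}. y j q' (t+1) =
        (\<Sum>q=0..t-1. (y j q t - abar j t q * x j q t) * K j q q'
                     + abar j t q * x j q t * K j (q+1) q')) \<and>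
     (\<forall>j\<in>{1..n}. y j 0 1 = 1) \<and>
     (\<forall>j\<in>{1..n}. \<forall>q\<ge>1. y j q 1 = 0)"

definition molp_optimal ::
    "(nat \<Rightarrow> nat \<Rightarrow> nat \<Rightarrow> real) \<Rightarrow> (nat \<Rightarrow> nat \<Rightarrow> nat \<Rightarrow> real) \<Rightarrow> bool" where
  "molp_optimal x y \<longleftrightarrow> molp_feasible x y \<and>
     (\<forall>x' y'. molp_feasible x' y' \<longrightarrow> molp_objective x' \<le> molp_objective x)"

definition argmax_set :: "nat \<Rightarrow> (nat \<Rightarrow> nat) \<Rightarrow> nat set \<Rightarrow> nat set" where
  "argmax_set t Q S = {j \<in> S. \<forall>k\<in>S.
      r k * abar k t (Q k) * kappa k (Q k) t \<le> r j * abar j t (Q j) * kappa j (Q j) t}"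

text \<open>A fixed tie-breaking rule is a choice function on nonempty sets of services.\<close>

definition tie_breaking :: "(nat set \<Rightarrow> nat) \<Rightarrow> bool" where
  "tie_breaking pick \<longleftrightarrow> (\<forall>M. M \<noteq> {} \<and> M \<subseteq> {1..n} \<longrightarrow> pick M \<in> M)"

text \<open>
  The weights \<open>w\<close> and \<open>bhat_weight\<close> are the numbers prescribed by the algorithm. In \<open>lpga_step\<close> they
  enter through \<open>bernoulli_pmf\<close> and \<open>embed_pmf\<close>, which are total: an argument of \<open>bernoulli_pmf\<close>
  outside the unit interval is clamped, and \<open>embed_pmf\<close> is unspecified unless its argument is
  nonnegative with total mass 1. That neither situation arises is the content of
  \<open>lpga_well_defined\<close> below.
\<close>

definition w :: "(nat \<Rightarrow> nat \<Rightarrow> nat \<Rightarrow> real) \<Rightarrow> (nat \<Rightarrow> nat \<Rightarrow> nat \<Rightarrow> real)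
    \<Rightarrow> nat \<Rightarrow> (nat \<Rightarrow> nat) \<Rightarrow> (nat \<Rightarrow> nat) \<Rightarrow> nat \<Rightarrow> real" where
  "w x y t Q Qh j =
     (if abar j t (Q j) > 0
      then theta x y j (Qh j) t * abar j t (Qh j) / abar j t (Q j) else 0)"

definition bhat_weight :: "nat \<Rightarrow> nat \<Rightarrow> nat \<Rightarrow> real" where
  "bhat_weight j qp b =
     (if b \<ge> qp then pmf (xi j) b / measure_pmf.prob (xi j) {qp..} else 0)"

definition bhat_pmf :: "nat \<Rightarrow> nat \<Rightarrow> nat \<Rightarrow> nat pmf" where
  "bhat_pmf j qp q' =
     (if q' > 0 then return_pmf (qp - q') else embed_pmf (bhat_weight j qp))"

definition lpga_step :: "(nat \<Rightarrow> nat \<Rightarrow> nat \<Rightarrow> real) \<Rightarrow> (nat \<Rightarrow> nat \<Rightarrow> nat \<Rightarrow> real)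
    \<Rightarrow> (nat set \<Rightarrow> nat) \<Rightarrow> lpga_period list \<Rightarrow> lpga_period pmf" where
  "lpga_step x y pick h = do {
     let t = length h + 1;
     let Q = queue_after h;
     let Qh = vqueue_after h;
     I \<leftarrow> Pi_pmf {1..n} False (\<lambda>j. bernoulli_pmf (w x y t Q Qh j));
     let S = {j \<in> {1..n}. I j};
     let J = (if S = {} then None else Some (pick (argmax_set t Q S)));
     arr \<leftarrow> bernoulli_pmf (lam t);
     let rec = (if arr then J else None);
     A \<leftarrow> join_pmf Q rec;
     Q' \<leftarrow> serve_pmf (\<lambda>j. Q j + A j);
     Ah \<leftarrow> Pi_pmf {1..n} 0 (\<lambda>k.
        if J = Some k then return_pmf (A k)
        else if k \<in> S then map_pmf of_bool (bernoulli_pmf (abar k t (Q k)))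
        else return_pmf 0);
     Bh \<leftarrow> Pi_pmf {1..n} 0 (\<lambda>j. bhat_pmf j (Q j + A j) (Q' j));
     return_pmf \<lparr>queue = Q, arrived = arr, recommended = rec, joins = A, next_queue = Q',
                 vqueue = Qh, sampled = S, selected = J, vjoins = Ah, vservice = Bh,
                 next_vqueue = (\<lambda>j. Qh j + Ah j - Bh j)\<rparr>
   }"

primrec lpga_run :: "(nat \<Rightarrow> nat \<Rightarrow> nat \<Rightarrow> real) \<Rightarrow> (nat \<Rightarrow> nat \<Rightarrow> nat \<Rightarrow> real)
    \<Rightarrow> (nat set \<Rightarrow> nat) \<Rightarrow> nat \<Rightarrow> lpga_period list pmf" where
  "lpga_run x y pick 0 = return_pmf []"
| "lpga_run x y pick (Suc k) = do {
     h \<leftarrow> lpga_run x y pick k;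
     p \<leftarrow> lpga_step x y pick h;
     return_pmf (h @ [p])
   }"

definition lpga_well_defined :: "(nat \<Rightarrow> nat \<Rightarrow> nat \<Rightarrow> real) \<Rightarrow> (nat \<Rightarrow> nat \<Rightarrow> nat \<Rightarrow> real)
    \<Rightarrow> (nat set \<Rightarrow> nat) \<Rightarrow> bool" where
  "lpga_well_defined x y pick \<longleftrightarrow>
     (AE h in measure_pmf (lpga_run x y pick T). \<forall>t\<in>{1..T}. \<forall>j\<in>{1..n}.
        let p = h ! (t - 1); q = queue p j; qp = q + joins p j in
        0 \<le> w x y t (queue p) (vqueue p) j \<and> w x y t (queue p) (vqueue p) j \<le> 1 \<and>
        0 \<le> a j q \<and> a j q \<le> 1 \<and>
        0 \<le> abar j t q \<and> abar j t q \<le> 1 \<and>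
        (next_queue p j = 0 \<longrightarrow>
           0 < measure_pmf.prob (xi j) {qp..} \<and>
           (\<forall>b. 0 \<le> bhat_weight j qp b) \<and> bhat_weight j qp sums 1) \<and>
        (sampled p \<noteq> {} \<longrightarrow> argmax_set t (queue p) (sampled p) \<noteq> {}))"

definition lpga_expected_revenue :: "(nat \<Rightarrow> nat \<Rightarrow> nat \<Rightarrow> real)
    \<Rightarrow> (nat \<Rightarrow> nat \<Rightarrow> nat \<Rightarrow> real) \<Rightarrow> (nat set \<Rightarrow> nat) \<Rightarrow> real" where
  "lpga_expected_revenue x y pick = measure_pmf.expectation (lpga_run x y pick T) net_revenue"

end

end

theory Submission
  imports Defs
begin

text \<open>
  The function \<open>backlog j q t\<close> is the expected number of \<open>q\<close> waiting customers that are still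
  unserved after period \<open>T\<close>. It is a martingale under service, and one more customer raises it by
  \<open>1 - kappa j q t\<close>, so a join at queue length \<open>q\<close> is worth \<open>r j * kappa j q t\<close> in net revenue.
  Occupation and recommendation probabilities of any policy then form a feasible point of the
  linear program with objective value equal to its revenue.

  For the algorithm, the virtual capacities are an exact resampling of the true ones, and each
  virtual join has probability \<open>theta * abar\<close> at the virtual state. Hence the virtual queues are
  independent Markov chains with marginals \<open>y\<close>, and they dominate the actual queues pathwise.
  Given the history, the expected maximum of the offered gains only decreases when actual states
  are replaced by virtual ones. After averaging over the independent virtual queues, the offers are
  independent with total offer probability at most 1, and the expected maximum of such variables is
  at least \<open>1 - 1/e\<close> times the sum of their means.
\<close>

section \<open>Expectations and products of probability mass functions\<close>

text \<open>The obstacle is correlation: a single recommendation per period couples the actual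
  queues, so a bound for the maximum of independent variables cannot be applied to them. Giving
  every sampled but unselected service a simulated join removes the coupling on the virtual side.
  Domination then pays off through monotonicity in the queue length. First, \<open>abar\<close> at
  the actual state is at least \<open>abar\<close> at the virtual state, so \<open>w\<close> is at
  most \<open>theta\<close> and hence a probability. Moreover \<open>w\<close> is calibrated so that
  being sampled and then joining has the same probability at either state. Finally
  \<open>kappa\<close> is no smaller at the shorter queue, so the mean gain can only grow. A smaller
  probability with no smaller mean is a comparison in the increasing convex order, which survives
  maxima of independent variables. The constant is the slope of the chord of
  \<open>1 - exp (- s)\<close> over the unit interval, which is where the LP confines the total
  offer probability.\<close>

lemma expectation_bind_pmf:
  fixes h :: "'b \<Rightarrow> real"
  assumes bd: "\<And>x y. x \<in> set_pmf p \<Longrightarrow> y \<in> set_pmf (f x) \<Longrightarrow> \<bar>h y\<bar> \<le> C"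
  shows "measure_pmf.expectation (p \<bind> f) h
         = measure_pmf.expectation p (\<lambda>x. measure_pmf.expectation (f x) h)"
proof -
  \<comment> \<open>\<open>h\<close> is bounded only on the support; setting it to 0 elsewhere gives
    a function bounded everywhere and changes none of the expectations.\<close>
  define g where "g y = (if y \<in> set_pmf (p \<bind> f) then h y else 0)" for y
  have C: "C \<ge> 0"
  proof -
    obtain x where x: "x \<in> set_pmf p" using set_pmf_not_empty[of p] by blast
    moreover obtain y where "y \<in> set_pmf (f x)" using set_pmf_not_empty[of "f x"] by blast
    ultimately show ?thesis using bd[of x y] by linarith
  qed
  have g: "\<bar>g y\<bar> \<le> C" for y
    using bd C by (auto simp: g_def)
  have "measure_pmf.expectation (p \<bind> f) h = measure_pmf.expectation (p \<bind> f) g"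
    by (intro integral_cong_AE) (auto simp: AE_measure_pmf_iff g_def)
  also have "\<dots> = measure_pmf.expectation p (\<lambda>x. measure_pmf.expectation (f x) g)"
    unfolding measure_pmf_bind
    by (rule integral_bind[where K="count_space UNIV" and B'=1 and B=C])
       (use g in \<open>auto simp: measure_pmf.emeasure_space_1 AE_measure_pmf_iff
           measure_pmf_in_subprob_space\<close>)
  also have "\<dots> = measure_pmf.expectation p (\<lambda>x. measure_pmf.expectation (f x) h)"
    by (intro integral_cong_AE) (auto simp: AE_measure_pmf_iff g_def intro!: integral_cong_AE)
  finally show ?thesis .
qed

lemma integrable_pmf_bounded:
  fixes h :: "'a \<Rightarrow> real"
  assumes "\<And>x. x \<in> set_pmf p \<Longrightarrow> \<bar>h x\<bar> \<le> C"
  shows "integrable (measure_pmf p) h"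
  using assms by (intro measure_pmf.integrable_const_bound[where B=C]) (auto simp:
      AE_measure_pmf_iff)

lemma expectation_cong_pmf:
  fixes f g :: "'a \<Rightarrow> real"
  assumes "\<And>x. x \<in> set_pmf p \<Longrightarrow> f x = g x"
  shows "measure_pmf.expectation p f = measure_pmf.expectation p g"
  using assms by (intro integral_cong_AE) (auto simp: AE_measure_pmf_iff)

lemma expectation_mono_pmf:
  fixes f g :: "'a \<Rightarrow> real"
  assumes "\<And>x. x \<in> set_pmf p \<Longrightarrow> f x \<le> g x"
    and "\<And>x. x \<in> set_pmf p \<Longrightarrow> \<bar>f x\<bar> \<le> C" "\<And>x. x \<in> set_pmf p \<Longrightarrow> \<bar>g x\<bar> \<le> D"
  shows "measure_pmf.expectation p f \<le> measure_pmf.expectation p g"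
  using assms by (intro integral_mono_AE integrable_pmf_bounded[of p f C]
      integrable_pmf_bounded[of p g D])
    (auto simp: AE_measure_pmf_iff)

lemma abs_expectation_le:
  fixes f :: "'a \<Rightarrow> real"
  assumes "\<And>x. x \<in> set_pmf p \<Longrightarrow> \<bar>f x\<bar> \<le> C"
  shows "\<bar>measure_pmf.expectation p f\<bar> \<le> C"
proof -
  have "\<bar>measure_pmf.expectation p f\<bar> \<le> measure_pmf.expectation p (\<lambda>x. \<bar>f x\<bar>)"
    by (rule integral_abs_bound)
  also have "\<dots> \<le> C"
    using assms by (intro measure_pmf.integral_le_const integrable_pmf_bounded[where C=C]) (auto
        simp: AE_measure_pmf_iff)
  finally show ?thesis .
qed

lemma expectation_pmf_of_bool: "measure_pmf.expectation p (\<lambda>x. of_bool (P x)) = measure_pmf.prob p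
    {x. P x}"
proof -
  have "(\<lambda>x. of_bool (P x) :: real) = indicator {x. P x}" by (auto simp: indicator_def)
  then show ?thesis by simp
qed

lemma sum_of_bool_eq:
  fixes g :: "nat \<Rightarrow> real"
  assumes "m \<le> N"
  shows "(\<Sum>q=0..N. of_bool (m = q) * g q) = g m"
proof -
  have "(\<Sum>q=0..N. of_bool (m = q) * g q) = (\<Sum>q=0..N. if q = m then g q else 0)"
    by (rule sum.cong) auto
  then show ?thesis using assms by simp
qed

lemma map_Pi_pmf:
  assumes "finite A"
  shows "map_pmf (\<lambda>f x. if x \<in> A then g x (f x) else d) (Pi_pmf A d' p) = Pi_pmf A d (\<lambda>x. map_pmf
      (g x) (p x))"
  using assms by (simp add: map_pmf_def Pi_pmf_bind[where d'=d'])

lemma Pi_pmf_memD: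
  "f \<in> set_pmf (Pi_pmf A d p) \<Longrightarrow> finite A \<Longrightarrow> x \<in> A \<Longrightarrow> f x \<in> set_pmf (p x)"
  "f \<in> set_pmf (Pi_pmf A d p) \<Longrightarrow> finite A \<Longrightarrow> x \<notin> A \<Longrightarrow> f x = d"
  by (auto simp: set_Pi_pmf PiE_dflt_def)

text \<open>Needed in two places: arrival followed by acceptance gives \<open>lam t * a\<close>, and
  sampling followed by a virtual join gives \<open>w * abar\<close>.\<close>

lemma bernoulli_thin:
  fixes u v :: real
  assumes "0 \<le> u" "u \<le> 1" "0 \<le> v" "v \<le> 1"
  shows "bernoulli_pmf u \<bind> (\<lambda>i. if i then bernoulli_pmf v else return_pmf False) = bernoulli_pmf
      (u * v)"
proof (rule pmf_eqI)
  fix b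
  have "0 \<le> u * v" "u * v \<le> 1" using assms by (auto intro: mult_le_one)
  then show "pmf (bernoulli_pmf u \<bind> (\<lambda>i. if i then bernoulli_pmf v else return_pmf False)) b
     = pmf (bernoulli_pmf (u * v)) b"
    using assms by (cases b) (simp_all add: pmf_bind algebra_simps)
qed

lemma map_bind_if: "map_pmf f ((p :: bool pmf) \<bind> (\<lambda>i. if i then q else q')) = p \<bind> (\<lambda>i. if i then
    map_pmf f q else map_pmf f q')"
  by (simp add: map_bind_pmf if_distrib)

lemma cond_pmf_singleton: "x \<in> set_pmf p \<Longrightarrow> cond_pmf p {x} = return_pmf x"
  by (rule pmf_eqI) (auto simp: pmf_cond measure_pmf_single indicator_def set_pmf_eq)

text \<open>Revealing one coordinate early does not change a product law. This is the situation of
  the selected service, whose actual join is known before the remaining virtual joins are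
  drawn.\<close>

lemma Pi_pmf_bind_component:
  assumes "finite A" "m \<in> A"
  shows "X \<bind> (\<lambda>v. Pi_pmf A d (\<lambda>k. if k = m then return_pmf v else G k))
       = Pi_pmf A d (\<lambda>k. if k = m then X else G k)"
proof -
  have "Pi_pmf A d (\<lambda>k. if k = m then X else G k)
      = Pi_pmf A d (\<lambda>k. X \<bind> (\<lambda>v. if k = m then return_pmf v else G k))"
    by (rule Pi_pmf_cong) (auto simp: bind_return_pmf')
  \<comment> \<open>The product rule for bind gives each coordinate its own copy of
    \<open>X\<close>, but only copy \<open>m\<close> is read; this lets \<open>f k\<close> become
    \<open>f m\<close> and the product collapse to its component.\<close>
  also have "\<dots> = Pi_pmf A d (\<lambda>_. X) \<bind> (\<lambda>f. Pi_pmf A d (\<lambda>k. if k = m then return_pmf (f k) else G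
      k))"
    by (rule Pi_pmf_bind[OF assms(1)])
  also have "\<dots> = Pi_pmf A d (\<lambda>_. X) \<bind> (\<lambda>f. Pi_pmf A d (\<lambda>k. if k = m then return_pmf (f m) else G
      k))"
    by (intro bind_pmf_cong refl Pi_pmf_cong) auto
  also have "\<dots> = map_pmf (\<lambda>f. f m) (Pi_pmf A d (\<lambda>_. X)) \<bind> (\<lambda>v. Pi_pmf A d (\<lambda>k. if k = m then
      return_pmf v else G k))"
    by (simp add: bind_map_pmf)
  finally show ?thesis using assms by (simp add: Pi_pmf_component)
qed

section \<open>Maximum of independent random variables\<close>

text \<open>Layer cake for finitely many values: each value is the sum of the increments up to it.
  One family of layers serves all of \<open>V\<close> and 0 at once; \<open>0 \<le> c i\<close> lets
  layerwise inequalities be added up, and \<open>0 < s i\<close> keeps the thresholds above the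
  floor 0 of the maximum.\<close>

lemma threshold_decomposition:
  fixes V :: "real set"
  assumes "finite V" "\<And>v. v \<in> V \<Longrightarrow> 0 \<le> v"
  shows "\<exists>(c :: nat \<Rightarrow> real) s m. (\<forall>i<m. 0 \<le> c i \<and> 0 < s i) \<and> (\<forall>v\<in>insert 0 V. v = (\<Sum>i<m. c i *
      of_bool (s i \<le> v)))"
  using assms
proof (induction V rule: finite_linorder_max_induct)
  case empty
  show ?case by (intro exI[of _ "\<lambda>_. 0"] exI[of _ 0]) auto
next
  case (insert b V)
  then obtain c :: "nat \<Rightarrow> real" and s :: "nat \<Rightarrow> real" and m where *: "\<forall>i<m. 0 \<le> c i \<and> 0 < s i"
     "\<forall>v\<in>Set.insert 0 V. v = (\<Sum>i<m. c i * of_bool (s i \<le> v))"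
    by auto
  show ?case
  proof (cases "b = 0")
    case True
    then show ?thesis using * by auto
  next
    case False
    then have b: "b > 0" using insert.prems by fastforce
    \<comment> \<open>The new top value \<open>b\<close> gets an extra layer of height
      \<open>b - M\<close>, where \<open>M\<close> is the largest old value.\<close>
    define M where "M = Max (insert 0 V)"
    have M: "M \<in> insert 0 V" unfolding M_def using insert.hyps by (intro Max_in) auto
    have Mge: "v \<in> insert 0 V \<Longrightarrow> v \<le> M" for v unfolding M_def using insert.hyps by (intro Max_ge)
        auto
    have Mb: "M < b" using M b insert.hyps by auto
    \<comment> \<open>Old layers with threshold above \<open>M\<close> are invisible on
      \<open>insert 0 V\<close>, but \<open>b\<close> might reach them. They get height 0, and the
      threshold \<open>b\<close> keeps \<open>s'\<close> positive.\<close>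
    define s' where "s' i = (if i < m \<and> s i \<le> M then s i else b)" for i
    define c' where "c' i = (if i < m then (if s i \<le> M then c i else 0) else b - M)" for i
    show ?thesis
    proof (rule exI[of _ c'], rule exI[of _ s'], rule exI[of _ "Suc m"], intro conjI ballI)
      show "\<forall>i<Suc m. 0 \<le> c' i \<and> 0 < s' i" using * Mb b by (auto simp: c'_def s'_def)
      fix v assume v: "v \<in> insert 0 (insert b V)"
      show "v = (\<Sum>i<Suc m. c' i * of_bool (s' i \<le> v))"
      proof (cases "v = b")
        case True
        have "(\<Sum>i<Suc m. c' i * of_bool (s' i \<le> v)) = (\<Sum>i<m. c i * of_bool (s i \<le> M)) + (b - M)"
        proof -
          have "(\<Sum>i<m. c' i * of_bool (s' i \<le> v)) = (\<Sum>i<m. c i * of_bool (s i \<le> M))"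
            using True Mb by (intro sum.cong refl) (simp add: c'_def s'_def)
          then show ?thesis using True by (simp add: c'_def s'_def)
        qed
        also have "\<dots> = b" using *(2) M by force
        finally show ?thesis using True by simp
      next
        case False
        then have vV: "v \<in> insert 0 V" using v by auto
        have vb: "v \<le> M" "v < b" using Mge[OF vV] Mb by auto
        have "(\<Sum>i<Suc m. c' i * of_bool (s' i \<le> v)) = (\<Sum>i<m. c i * of_bool (s i \<le> v))"
        proof -
          have "(\<Sum>i<m. c' i * of_bool (s' i \<le> v)) = (\<Sum>i<m. c i * of_bool (s i \<le> v))"
            using vb by (intro sum.cong refl) (simp add: c'_def s'_def)
          then show ?thesis using vb by (simp add: c'_def s'_def)
        qed
        also have "\<dots> = v" using *(2) vV by force
        finally show ?thesis by simp
      qed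
    qed
  qed
qed

text \<open>Convexity keeps \<open>exp (- s)\<close> below its chord, which falls from 1 at
  \<open>s = 0\<close> to \<open>1 / exp 1\<close> at \<open>s = 1\<close>. This is the origin of
  the approximation ratio.\<close>

lemma one_minus_exp_ge:
  fixes s :: real
  assumes "0 \<le> s" "s \<le> 1"
  shows "1 - exp (- s) \<ge> (1 - 1 / exp 1) * s"
proof -
  have cv: "convex_on UNIV (exp :: real \<Rightarrow> real)"
    by (intro f''_ge0_imp_convex) (auto intro!: derivative_eq_intros)
  have "exp ((1 - s) *\<^sub>R 0 + s *\<^sub>R (-1)) \<le> (1 - s) * exp 0 + s * exp (-1)"
    using assms by (intro convex_onD[OF cv]) auto
  then show ?thesis by (simp add: exp_minus field_simps)
qed

text \<open>The bound \<open>1 - p \<le> exp (- p)\<close> turns the product into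
  \<open>exp (- sum p A)\<close>; the cap on the sum places the exponent in the range where the
  chord bound holds.\<close>

lemma one_minus_prod_ge:
  fixes p :: "'a \<Rightarrow> real"
  assumes "finite A" "\<And>i. i \<in> A \<Longrightarrow> 0 \<le> p i" "\<And>i. i \<in> A \<Longrightarrow> p i \<le> 1" "sum p A \<le> 1"
  shows "1 - (\<Prod>i\<in>A. 1 - p i) \<ge> (1 - 1 / exp 1) * sum p A"
proof -
  have "(\<Prod>i\<in>A. 1 - p i) \<le> (\<Prod>i\<in>A. exp (- p i))"
  proof (intro prod_mono conjI)
    fix i assume "i \<in> A"
    then show "0 \<le> 1 - p i" using assms by simp
    show "1 - p i \<le> exp (- p i)" using exp_ge_add_one_self[of "- p i"] by simp
  qed
  also have "\<dots> = exp (- sum p A)"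
    using assms(1) by (simp add: exp_sum sum_negf[symmetric])
  finally show ?thesis using one_minus_exp_ge[of "sum p A"] assms by (simp add: sum_nonneg)
qed

text \<open>The floor \<open>m\<close> makes the maximum meaningful for empty \<open>A\<close> and
  acts as an accumulator in inductions, where a coordinate that is peeled off is merged into
  it.\<close>

definition bmax :: "real \<Rightarrow> ('a \<Rightarrow> real) \<Rightarrow> 'a set \<Rightarrow> real" where
  "bmax m z A = Max (insert m (z ` A))"

lemma bmax_insert: "finite A \<Longrightarrow> bmax m z (insert j A) = bmax (max m (z j)) z A"
  unfolding bmax_def
  by (cases "z ` A = {}") (auto simp: insert_commute max.assoc max.commute max.left_commute)

lemma bmax_max: "finite A \<Longrightarrow> bmax (max m m') z A = max (bmax m z A) m'"
  unfolding bmax_def by (cases "z ` A = {}") (auto simp: max.assoc max.commute max.left_commute)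

lemma bmax_cong: "(\<And>j. j \<in> A \<Longrightarrow> z j = z' j) \<Longrightarrow> bmax m z A = bmax m z' A"
  unfolding bmax_def by (metis image_cong)

lemma bmax_bounds:
  assumes "finite A" "0 \<le> m" "m \<le> C" "\<And>j. j \<in> A \<Longrightarrow> z j \<le> C"
  shows "0 \<le> bmax m z A" "bmax m z A \<le> C"
  unfolding bmax_def using assms by (auto simp: Max_ge_iff)

lemma ge_bmax_iff: "finite A \<Longrightarrow> s \<le> bmax m z A \<longleftrightarrow> s \<le> m \<or> (\<exists>j\<in>A. s \<le> z j)"
  unfolding bmax_def by (auto simp: Max_ge_iff)

lemma bmax_in: "finite A \<Longrightarrow> bmax m z A \<in> insert m (z ` A)"
  unfolding bmax_def by (intro Max_in) auto

text \<open>The two orders of integration. Integrating \<open>j\<close> outermost moves its value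
  into the floor, as an induction hypothesis for \<open>A\<close> requires; integrating
  \<open>j\<close> innermost exposes a single coordinate against a fixed level.\<close>

lemma expectation_bmax_insert:
  fixes p :: "'a \<Rightarrow> real pmf"
  assumes fin: "finite A" "j \<notin> A" and m: "0 \<le> m"
    and p: "\<And>i z. i \<in> insert j A \<Longrightarrow> z \<in> set_pmf (p i) \<Longrightarrow> z \<le> C"
  shows "measure_pmf.expectation (Pi_pmf (insert j A) 0 p) (\<lambda>z. bmax m z (insert j A))
    = measure_pmf.expectation (p j) (\<lambda>v. measure_pmf.expectation (Pi_pmf A 0 p) (\<lambda>z. bmax (max m
        v) z A))"
    and "measure_pmf.expectation (Pi_pmf (insert j A) 0 p) (\<lambda>z. bmax m z (insert j A))
    = measure_pmf.expectation (Pi_pmf A 0 p) (\<lambda>z. measure_pmf.expectation (p j) (\<lambda>v. max (bmax m z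
        A) v))"
proof -
  have A: "z i \<le> C" if "z \<in> set_pmf (Pi_pmf A 0 p)" "i \<in> A" for z i
    using set_Pi_pmf_subset'[OF fin(1), of 0 p] that p by (force simp: PiE_dflt_def)
  have bd: "\<bar>bmax (max m v) z A\<bar> \<le> max m C" if "v \<in> set_pmf (p j)" "z \<in> set_pmf (Pi_pmf A 0 p)"
      for v z
  proof -
    have "v \<le> C" using p that by auto
    then have *: "0 \<le> max m v" "max m v \<le> max m C" using m by auto
    have **: "z i \<le> max m C" if "i \<in> A" for i using A[OF \<open>z \<in> _\<close> that] by simp
    from bmax_bounds[where z=z, OF fin(1) * **] have "0 \<le> bmax (max m v) z A" "bmax (max m v) z A
        \<le> max m C"
      by blast+
    then show ?thesis by linarith
  qed
  have upd: "bmax m (z(j := v)) (insert j A) = bmax (max m v) z A" for z v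
    using fin by (simp add: bmax_insert) (intro bmax_cong, auto)
  have sw1: "Pi_pmf (insert j A) 0 p = p j \<bind> (\<lambda>v. map_pmf (\<lambda>z. z(j := v)) (Pi_pmf A 0 p))"
    using fin by (subst Pi_pmf_insert') (auto simp: map_pmf_def)
  show "measure_pmf.expectation (Pi_pmf (insert j A) 0 p) (\<lambda>z. bmax m z (insert j A))
    = measure_pmf.expectation (p j) (\<lambda>v. measure_pmf.expectation (Pi_pmf A 0 p) (\<lambda>z. bmax (max m
        v) z A))"
    unfolding sw1 using bd
    by (subst expectation_bind_pmf[where C="max m C"]) (auto simp: upd)
  have sw: "Pi_pmf (insert j A) 0 p = Pi_pmf A 0 p \<bind> (\<lambda>z. map_pmf (\<lambda>v. z(j := v)) (p j))"
    using fin by (subst Pi_pmf_insert') (auto simp: map_pmf_def intro: bind_commute_pmf)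
  show "measure_pmf.expectation (Pi_pmf (insert j A) 0 p) (\<lambda>z. bmax m z (insert j A))
    = measure_pmf.expectation (Pi_pmf A 0 p) (\<lambda>z. measure_pmf.expectation (p j) (\<lambda>v. max (bmax m z
        A) v))"
    unfolding sw using bd fin(1)
    by (subst expectation_bind_pmf[where C="max m C"]) (auto simp: upd bmax_max)
qed

text \<open>Assumption \<open>le\<close> is the increasing convex order, tested at levels
  \<open>m \<ge> 0\<close>. It passes to the maximum by exchanging one coordinate at a time: with
  the others fixed, the maximum is \<open>max m v\<close> for a level \<open>m\<close> that does not
  depend on \<open>v\<close>.\<close>

lemma expectation_bmax_mono:
  fixes p p' :: "'a \<Rightarrow> real pmf"
  assumes fin: "finite A" and m: "0 \<le> m"
    and p: "\<And>i z. i \<in> A \<Longrightarrow> z \<in> set_pmf (p i) \<Longrightarrow> z \<le> C"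
    and p': "\<And>i z. i \<in> A \<Longrightarrow> z \<in> set_pmf (p' i) \<Longrightarrow> z \<le> C"
    and le: "\<And>i m. i \<in> A \<Longrightarrow> 0 \<le> m \<Longrightarrow>
      measure_pmf.expectation (p' i) (\<lambda>v. max m v) \<le> measure_pmf.expectation (p i) (\<lambda>v. max m v)"
  shows "measure_pmf.expectation (Pi_pmf A 0 p') (\<lambda>z. bmax m z A)
         \<le> measure_pmf.expectation (Pi_pmf A 0 p) (\<lambda>z. bmax m z A)"
  using fin m p p' le
proof (induction A arbitrary: m rule: finite_induct)
  case empty
  then show ?case by simp
next
  case (insert j A)
  define D where "D = max m C"
  have D: "m \<le> D" "C \<le> D" "0 \<le> D" using insert.prems(1) by (auto simp: D_def)
  have bA: "\<bar>bmax m' z A\<bar> \<le> D" if "0 \<le> m'" "m' \<le> D" and z: "z \<in> set_pmf (Pi_pmf A 0 q)"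
      and q: "\<And>i v. i \<in> A \<Longrightarrow> v \<in> set_pmf (q i) \<Longrightarrow> v \<le> C" for m' z and q :: "'a \<Rightarrow> real pmf"
  proof -
    have *: "z i \<le> D" if "i \<in> A" for i
      using set_Pi_pmf_subset'[OF insert.hyps(1), of 0 q] z q[OF that] that D by (force simp:
          PiE_dflt_def)
    from bmax_bounds[where z=z, OF insert.hyps(1) \<open>0 \<le> m'\<close> \<open>m' \<le> D\<close> *] show ?thesis by linarith
  qed
  have "measure_pmf.expectation (Pi_pmf (insert j A) 0 p') (\<lambda>z. bmax m z (insert j A))
    = measure_pmf.expectation (p' j) (\<lambda>v. measure_pmf.expectation (Pi_pmf A 0 p') (\<lambda>z. bmax (max m
        v) z A))"
    by (rule expectation_bmax_insert(1)[where C=C]) (use insert in auto)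
  also have "\<dots> \<le> measure_pmf.expectation (p' j) (\<lambda>v. measure_pmf.expectation (Pi_pmf A 0 p) (\<lambda>z.
      bmax (max m v) z A))"
  proof (rule expectation_mono_pmf)
    fix v assume v: "v \<in> set_pmf (p' j)"
    then have vC: "v \<le> C" using insert.prems by auto
    have mv: "0 \<le> max m v" "max m v \<le> D" using insert.prems(1) vC D by auto
    show "measure_pmf.expectation (Pi_pmf A 0 p') (\<lambda>z. bmax (max m v) z A)
      \<le> measure_pmf.expectation (Pi_pmf A 0 p) (\<lambda>z. bmax (max m v) z A)"
      by (rule insert.IH) (use insert.prems mv in auto)
    show "\<bar>measure_pmf.expectation (Pi_pmf A 0 p') (\<lambda>z. bmax (max m v) z A)\<bar> \<le> D"
      by (rule abs_expectation_le, rule bA[OF mv]) (use insert.prems in auto)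
    show "\<bar>measure_pmf.expectation (Pi_pmf A 0 p) (\<lambda>z. bmax (max m v) z A)\<bar> \<le> D"
      by (rule abs_expectation_le, rule bA[OF mv]) (use insert.prems in auto)
  qed
  also have "\<dots> = measure_pmf.expectation (Pi_pmf A 0 p) (\<lambda>z. measure_pmf.expectation (p' j) (\<lambda>v.
      max (bmax m z A) v))"
  proof -
    \<comment> \<open>The hybrid law takes coordinate \<open>j\<close> from \<open>p'\<close> and
      the others from \<open>p\<close>; for it the order of integration is reversed.\<close>
    let ?q = "p(j := p' j)"
    have [simp]: "Pi_pmf A 0 ?q = Pi_pmf A 0 p" by (rule Pi_pmf_cong) (use insert.hyps in auto)
    have "z \<le> C" if "i \<in> insert j A" "z \<in> set_pmf (?q i)" for i z
      using that insert.prems(2,3) by (auto split: if_splits)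
    from expectation_bmax_insert[where p="?q", OF insert.hyps(1,2) insert.prems(1) this] show
        ?thesis by simp
  qed
  also have "\<dots> \<le> measure_pmf.expectation (Pi_pmf A 0 p) (\<lambda>z. measure_pmf.expectation (p j) (\<lambda>v.
      max (bmax m z A) v))"
  proof (rule expectation_mono_pmf)
    fix z assume z: "z \<in> set_pmf (Pi_pmf A 0 p)"
    have *: "z i \<le> D" if "i \<in> A" for i
      using set_Pi_pmf_subset'[OF insert.hyps(1), of 0 p] z insert.prems(2) that D by (force simp:
          PiE_dflt_def)
    note b = bmax_bounds[where z=z, OF insert.hyps(1) insert.prems(1) D(1) *]
    show "measure_pmf.expectation (p' j) (\<lambda>v. max (bmax m z A) v) \<le> measure_pmf.expectation (p j)
        (\<lambda>v. max (bmax m z A) v)"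
      by (rule insert.prems(4)) (use b in auto)
    have "\<bar>max (bmax m z A) v\<bar> \<le> D" if "v \<in> set_pmf (p j) \<or> v \<in> set_pmf (p' j)" for v
    proof -
      have "v \<le> D" using that insert.prems(2,3)[of j v] D by auto
      then show ?thesis using b by (auto simp: max_def)
    qed
    then show "\<bar>measure_pmf.expectation (p' j) (\<lambda>v. max (bmax m z A) v)\<bar> \<le> D"
      "\<bar>measure_pmf.expectation (p j) (\<lambda>v. max (bmax m z A) v)\<bar> \<le> D"
      by (auto intro!: abs_expectation_le)
  qed
  also have "\<dots> = measure_pmf.expectation (Pi_pmf (insert j A) 0 p) (\<lambda>z. bmax m z (insert j A))"
    by (rule expectation_bmax_insert(2)[where C=C, symmetric]) (use insert in auto)
  finally show ?case .
qed

text \<open>A layer-cake argument: at each threshold the maximum succeeds with probability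
  \<open>1 - (\<Prod>i. 1 - p i)\<close>, where the success probabilities \<open>p i\<close> still sum to at most 1.\<close>

lemma expectation_bmax_ge:
  fixes p :: "'a \<Rightarrow> real pmf"
  assumes fin: "finite A"
    and finp: "\<And>i. i \<in> A \<Longrightarrow> finite (set_pmf (p i))"
    and nn: "\<And>i z. i \<in> A \<Longrightarrow> z \<in> set_pmf (p i) \<Longrightarrow> 0 \<le> z"
    and pos: "(\<Sum>i\<in>A. measure_pmf.prob (p i) {0<..}) \<le> 1"
  shows "measure_pmf.expectation (Pi_pmf A 0 p) (\<lambda>z. bmax 0 z A)
         \<ge> (1 - 1 / exp 1) * (\<Sum>i\<in>A. measure_pmf.expectation (p i) (\<lambda>v. v))"
proof -
  \<comment> \<open>One value set for all variables, so that a single decomposition applies to each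
    of them and also to their maximum, whose values lie in \<open>insert 0 V\<close>.\<close>
  define V where "V = (\<Union>i\<in>A. set_pmf (p i))"
  have V: "finite V" "\<And>v. v \<in> V \<Longrightarrow> 0 \<le> v" using fin finp nn by (auto simp: V_def)
  from threshold_decomposition[OF V] obtain c s :: "nat \<Rightarrow> real" and m where
    c: "\<And>i. i < m \<Longrightarrow> 0 \<le> c i" and s: "\<And>i. i < m \<Longrightarrow> 0 < s i"
    and dec: "\<And>v. v \<in> insert 0 V \<Longrightarrow> v = (\<Sum>i<m. c i * of_bool (s i \<le> v))" by blast
  have supp: "z j \<in> V" if "z \<in> set_pmf (Pi_pmf A 0 p)" "j \<in> A" for z j
    using set_Pi_pmf_subset'[OF fin, of 0 p] that by (force simp: PiE_dflt_def V_def)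
  have ex: "measure_pmf.expectation (p j) (\<lambda>v. v) = (\<Sum>i<m. c i * measure_pmf.prob (p j) {s i..})"
      if j: "j \<in> A" for j
  proof -
    have "measure_pmf.expectation (p j) (\<lambda>v. v) = measure_pmf.expectation (p j) (\<lambda>v. \<Sum>i<m. c i *
        of_bool (s i \<le> v))"
      by (rule expectation_cong_pmf, rule dec) (use j in \<open>auto simp: V_def\<close>)
    also have "\<dots> = (\<Sum>i<m. c i * measure_pmf.expectation (p j) (\<lambda>v. of_bool (s i \<le> v)))"
      by (subst Bochner_Integration.integral_sum) (auto intro!: integrable_measure_pmf_finite finp
          j)
    finally show ?thesis by (simp add: expectation_pmf_of_bool atLeast_def)
  qed
  have prod: "measure_pmf.expectation (Pi_pmf A 0 p) (\<lambda>z. of_bool (s i \<le> bmax 0 z A))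
     = 1 - (\<Prod>j\<in>A. 1 - measure_pmf.prob (p j) {s i..})" if i: "i < m" for i
  proof -
    have "measure_pmf.prob (Pi_pmf A 0 p) {z. s i \<le> bmax 0 z A} = 1 - measure_pmf.prob (Pi_pmf A 0
        p) (- {z. s i \<le> bmax 0 z A})"
      by (simp add: measure_pmf.prob_compl[of _ "Pi_pmf A 0 p", simplified] Compl_eq_Diff_UNIV)
    \<comment> \<open>Since \<open>s i > 0\<close>, the floor never reaches the threshold, so
      missing it is a product event.\<close>
    also have "- {z. s i \<le> bmax 0 z A} = Pi A (\<lambda>_. {..<s i})"
      using s[OF i] by (auto simp: ge_bmax_iff[OF fin] Pi_iff not_le[symmetric])
    also have "measure_pmf.prob (Pi_pmf A 0 p) (Pi A (\<lambda>_. {..<s i})) = (\<Prod>j\<in>A. measure_pmf.prob (p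
        j) {..<s i})"
      by (rule measure_Pi_pmf_Pi[OF fin])
    also have "\<dots> = (\<Prod>j\<in>A. 1 - measure_pmf.prob (p j) {s i..})"
    proof (rule prod.cong[OF refl])
      fix j
      have "{..<s i} = UNIV - {s i..}" by auto
      then show "measure_pmf.prob (p j) {..<s i} = 1 - measure_pmf.prob (p j) {s i..}"
        using measure_pmf.prob_compl[of "{s i..}" "p j"] by simp
    qed
    finally show ?thesis by (simp add: expectation_pmf_of_bool)
  qed
  have "measure_pmf.expectation (Pi_pmf A 0 p) (\<lambda>z. bmax 0 z A)
      = measure_pmf.expectation (Pi_pmf A 0 p) (\<lambda>z. \<Sum>i<m. c i * of_bool (s i \<le> bmax 0 z A))"
  proof (rule expectation_cong_pmf, rule dec)
    fix z assume "z \<in> set_pmf (Pi_pmf A 0 p)"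
    then show "bmax 0 z A \<in> insert 0 V" using bmax_in[OF fin, of 0 z] supp by auto
  qed
  also have "\<dots> = (\<Sum>i<m. c i * measure_pmf.expectation (Pi_pmf A 0 p) (\<lambda>z. of_bool (s i \<le> bmax 0 z
      A)))"
    by (subst Bochner_Integration.integral_sum) (auto intro!: integrable_pmf_bounded[where C=1])
  also have "\<dots> = (\<Sum>i<m. c i * (1 - (\<Prod>j\<in>A. 1 - measure_pmf.prob (p j) {s i..})))"
    by (simp add: prod)
  also have "\<dots> \<ge> (\<Sum>i<m. c i * ((1 - 1 / exp 1) * (\<Sum>j\<in>A. measure_pmf.prob (p j) {s i..})))"
  proof (intro sum_mono mult_left_mono one_minus_prod_ge fin)
    fix i assume i: "i \<in> {..<m}"
    \<comment> \<open>Reaching a positive threshold requires a positive value, so the cap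
      \<open>pos\<close> carries over to every layer.\<close>
    have "(\<Sum>j\<in>A. measure_pmf.prob (p j) {s i..}) \<le> (\<Sum>j\<in>A. measure_pmf.prob (p j) {0<..})"
      using s[of i] i by (intro sum_mono measure_pmf.finite_measure_mono) auto
    then show "(\<Sum>j\<in>A. measure_pmf.prob (p j) {s i..}) \<le> 1" using pos by linarith
  qed (use c in auto)
  also have "(\<Sum>i<m. c i * ((1 - 1 / exp 1) * (\<Sum>j\<in>A. measure_pmf.prob (p j) {s i..})))
     = (1 - 1 / exp 1) * (\<Sum>j\<in>A. \<Sum>i<m. c i * measure_pmf.prob (p j) {s i..})"
    by (subst sum.swap) (simp add: sum_distrib_left mult_ac)
  finally show ?thesis using ex by simp
qed

definition on_off :: "real \<Rightarrow> real \<Rightarrow> real pmf" where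
  "on_off p v = map_pmf (\<lambda>b. if b then v else 0) (bernoulli_pmf p)"

lemma expectation_on_off:
  assumes "0 \<le> p" "p \<le> 1"
  shows "measure_pmf.expectation (on_off p v) f = p * f v + (1 - p) * f (0::real)"
  using assms by (simp add: on_off_def algebra_simps)

lemma set_on_off: "set_pmf (on_off p v) \<subseteq> {0, v}"
  by (auto simp: on_off_def)

context dsr
begin

section \<open>Backlog potential and revenue of a run\<close>

definition backlog :: "nat \<Rightarrow> nat \<Rightarrow> nat \<Rightarrow> real" where
  "backlog j q t = measure_pmf.expectation (Pi_pmf {t..T} 0 (\<lambda>_. xi j))
     (\<lambda>B. real (q - (\<Sum>\<tau>=t..T. B \<tau>)))"

lemma backlog_bounds: "0 \<le> backlog j q t" "backlog j q t \<le> real q"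
proof -
  show "0 \<le> backlog j q t" unfolding backlog_def by (rule Bochner_Integration.integral_nonneg) simp
  have "\<bar>backlog j q t\<bar> \<le> real q" unfolding backlog_def by (rule abs_expectation_le) simp
  then show "backlog j q t \<le> real q" by linarith
qed

text \<open>Pathwise, the extra customer stands behind \<open>q\<close> others and stays unserved
  exactly when the remaining capacity is below \<open>q + 1\<close>.\<close>

lemma backlog_Suc: "backlog j (Suc q) t = backlog j q t + 1 - kappa j q t"
proof -
  let ?P = "Pi_pmf {t..T} 0 (\<lambda>_. xi j)" and ?s = "\<lambda>B :: nat \<Rightarrow> nat. \<Sum>\<tau>=t..T. B \<tau>"
  have "backlog j (Suc q) t = measure_pmf.expectation ?P (\<lambda>B. real (q - ?s B) + (1 - of_bool (q +
      1 \<le> ?s B)))"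
    unfolding backlog_def by (rule expectation_cong_pmf) auto
  also have "\<dots> = measure_pmf.expectation ?P (\<lambda>B. real (q - ?s B))
      + (1 - measure_pmf.expectation ?P (\<lambda>B. of_bool (q + 1 \<le> ?s B)))"
  proof -
    have 1: "integrable (measure_pmf ?P) (\<lambda>B. real (q - ?s B))"
      by (rule integrable_pmf_bounded[where C="real q"]) simp
    have 2: "integrable (measure_pmf ?P) (\<lambda>B. of_bool (q + 1 \<le> ?s B) :: real)"
      by (rule integrable_pmf_bounded[where C=1]) simp
    show ?thesis using 1 2
      by (subst Bochner_Integration.integral_add, simp, simp, subst
          Bochner_Integration.integral_diff) simp_all
  qed
  finally show ?thesis by (simp add: backlog_def kappa_def expectation_pmf_of_bool)
qed

lemma backlog_end: "backlog j q (Suc T) = real q"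
  by (simp add: backlog_def)

text \<open>Truncated subtraction composes, \<open>(q - b) - c = q - (b + c)\<close>, so serving
  period \<open>t\<close> separately merely shortens the queue seen by the later periods.\<close>

lemma backlog_step:
  assumes "t \<le> T"
  shows "backlog j q t = measure_pmf.expectation (xi j) (\<lambda>b. backlog j (q - b) (Suc t))"
proof -
  have iv: "{t..T} = insert t {Suc t..T}" using assms by auto
  have upd: "(\<Sum>\<tau>=Suc t..T. (f(t := b)) \<tau>) = (\<Sum>\<tau>=Suc t..T. f \<tau>)" for f :: "nat \<Rightarrow> nat" and b
    by (rule sum.cong) auto
  show ?thesis
    unfolding backlog_def iv
    by (subst Pi_pmf_insert', simp, simp, subst expectation_bind_pmf[where C="real q"])
       (auto simp: map_pmf_def[symmetric] upd simp del: fun_upd_apply, simp)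
qed

lemma kappa_bounds: "0 \<le> kappa j q t" "kappa j q t \<le> 1"
  by (auto simp: kappa_def)

lemma kappa_antimono: "q \<le> q' \<Longrightarrow> kappa j q' t \<le> kappa j q t"
  unfolding kappa_def by (intro measure_pmf.finite_measure_mono) auto

lemma serve_component:
  assumes "j \<in> {1..n}"
  shows "map_pmf (\<lambda>Q'. Q' j) (serve_pmf Qp) = map_pmf (\<lambda>b. Qp j - b) (xi j)"
proof -
  have "map_pmf (\<lambda>Q'. Q' j) (serve_pmf Qp)
      = map_pmf (\<lambda>b. Qp j - b) (map_pmf (\<lambda>B. B j) (Pi_pmf {1..n} 0 xi))"
    by (simp add: serve_pmf_def pmf.map_comp o_def)
  then show ?thesis using assms by (simp add: Pi_pmf_component)
qed

lemma serve_le: "Q' \<in> set_pmf (serve_pmf Qp) \<Longrightarrow> Q' j \<le> Qp j"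
  by (auto simp: serve_pmf_def)

lemma backlog_serve:
  assumes "j \<in> {1..n}" "t \<le> T"
  shows "measure_pmf.expectation (serve_pmf Qp) (\<lambda>Q'. backlog j (Q' j) (Suc t)) = backlog j (Qp j)
      t"
proof -
  have "measure_pmf.expectation (serve_pmf Qp) (\<lambda>Q'. backlog j (Q' j) (Suc t))
      = measure_pmf.expectation (map_pmf (\<lambda>Q'. Q' j) (serve_pmf Qp)) (\<lambda>q. backlog j q (Suc t))"
    by simp
  then show ?thesis by (simp only: serve_component[OF assms(1)] backlog_step[OF assms(2)]) simp
qed

section \<open>Revenue identity common to policies and to the algorithm\<close>

lemma queue_after_simps [simp]:
  "queue_after [] = (\<lambda>_. 0)" "queue_after (h @ [p]) = next_queue p"
  by (auto simp: queue_after_def)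

text \<open>\<open>R\<close>, \<open>S\<close> and \<open>L\<close> abstract the run, the step and
  the law of the joins. Policies and the algorithm share only the shape of the marginal in
  \<open>step\<close>: joins are drawn first, then service acts on the enlarged queues.\<close>

lemma run_queue_le:
  fixes R :: "nat \<Rightarrow> 'a period_scheme list pmf"
  assumes R0: "R 0 = return_pmf []"
    and RS: "\<And>k. R (Suc k) = do {h \<leftarrow> R k; p \<leftarrow> S h; return_pmf (h @ [p])}"
    and step: "\<And>h. map_pmf (\<lambda>p. (joins p, next_queue p)) (S h)
        = do {A \<leftarrow> L h; Q' \<leftarrow> serve_pmf (\<lambda>j. queue_after h j + A j); return_pmf (A, Q')}"
    and L: "\<And>h A j. A \<in> set_pmf (L h) \<Longrightarrow> A j \<le> 1"
    and h: "h \<in> set_pmf (R k)"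
  shows "length h = k" "queue_after h j \<le> k" "p \<in> set h \<Longrightarrow> joins p j \<le> 1"
  using h
proof (atomize (full), induction k arbitrary: h)
  case 0
  then show ?case by (simp add: R0)
next
  case (Suc k)
  then obtain h' p' where h': "h' \<in> set_pmf (R k)" "p' \<in> set_pmf (S h')" and h: "h = h' @ [p']"
    by (auto simp: RS)
  have "(joins p', next_queue p') \<in> set_pmf (map_pmf (\<lambda>p. (joins p, next_queue p)) (S h'))"
    using h'(2) by auto
  then have A: "joins p' \<in> set_pmf (L h')"
    and Q': "next_queue p' \<in> set_pmf (serve_pmf (\<lambda>j. queue_after h' j + joins p' j))"
    unfolding step by auto
  then show ?case using L[OF A, of j] serve_le[OF Q', of j] Suc.IH[of h'] h' h by auto
qed

text \<open>Revenue so far minus the weighted backlog drifts only through joins, since service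
  preserves the expected backlog (\<open>backlog_serve\<close>). Telescoping over the periods trades
  the terminal penalty for a factor \<open>kappa\<close> at the moment of each join.\<close>

lemma run_revenue:
  fixes R :: "nat \<Rightarrow> 'a period_scheme list pmf"
  assumes R0: "R 0 = return_pmf []"
    and RS: "\<And>k. R (Suc k) = do {h \<leftarrow> R k; p \<leftarrow> S h; return_pmf (h @ [p])}"
    and step: "\<And>h. map_pmf (\<lambda>p. (joins p, next_queue p)) (S h)
        = do {A \<leftarrow> L h; Q' \<leftarrow> serve_pmf (\<lambda>j. queue_after h j + A j); return_pmf (A, Q')}"
    and L: "\<And>h A j. A \<in> set_pmf (L h) \<Longrightarrow> A j \<le> 1"
  shows "measure_pmf.expectation (R T) net_revenue
    = (\<Sum>k<T. measure_pmf.expectation (R k) (\<lambda>h. measure_pmf.expectation (L h)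
        (\<lambda>A. \<Sum>j=1..n. r j * real (A j) * kappa j (queue_after h j) (Suc k))))"
proof -
  have supp: "length h = k" "queue_after h j \<le> k" "p \<in> set h \<Longrightarrow> joins p j \<le> 1"
    if "h \<in> set_pmf (R k)" for h k j p
    using run_queue_le[where R=R and S=S and L=L and h=h and k=k] R0 RS step L that by blast+
  \<comment> \<open>Joins are at most 1 and queues at most \<open>k\<close>, so multiples of
    \<open>W\<close> bound every integrand below and justify splitting the integrals.\<close>
  define W where "W = (\<Sum>j=1..n. r j)"
  have W: "(\<Sum>j=1..n. \<bar>r j * c j\<bar>) \<le> W * C" if "\<And>j. j \<in> {1..n} \<Longrightarrow> \<bar>c j\<bar> \<le> C" for c C
    unfolding W_def sum_distrib_right using that revenue_nonneg
    by (intro sum_mono) (auto simp: abs_mult intro: mult_left_mono)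
  have Wabs: "\<bar>\<Sum>j=1..n. r j * c j\<bar> \<le> W * C" if "\<And>j. j \<in> {1..n} \<Longrightarrow> \<bar>c j\<bar> \<le> C" for c C
    using W[of c C] that sum_abs[of "\<lambda>j. r j * c j" "{1..n}"] by (meson order_trans)
  define G :: "'a period_scheme list \<Rightarrow> real" where "G h = (\<Sum>p\<leftarrow>h. \<Sum>j=1..n. r j * real (joins p j))"
      for h
  \<comment> \<open>The potential starts at 0 and equals the net revenue at \<open>k = T\<close>. A
    history of length \<open>k\<close> describes the start of period \<open>k + 1\<close>, hence
    \<open>Suc k\<close>.\<close>
  define F where "F k h = G h - (\<Sum>j=1..n. r j * backlog j (queue_after h j) (Suc k))" for k h
  define g where "g k h = measure_pmf.expectation (L h)
        (\<lambda>A. \<Sum>j=1..n. r j * real (A j) * kappa j (queue_after h j) (Suc k))" for k h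
  have G: "\<bar>G h\<bar> \<le> W * real k" if "h \<in> set_pmf (R k)" for h k
  proof -
    have "\<bar>G h\<bar> \<le> (\<Sum>p\<leftarrow>h. \<bar>\<Sum>j=1..n. r j * real (joins p j)\<bar>)"
      unfolding G_def by (metis (no_types, lifting) ext map_map o_def sum_list_abs)
    also have "\<dots> \<le> (\<Sum>p\<leftarrow>h. W * 1)"
      by (intro sum_list_mono Wabs) (use supp(3)[OF that] in auto)
    also have "\<dots> = W * real k" using supp(1)[OF that] by (simp add: sum_list_triv)
    finally show ?thesis .
  qed
  have F: "\<bar>F k h\<bar> \<le> W * real k + W * real k" if "h \<in> set_pmf (R k)" for h k
  proof -
    have "\<bar>\<Sum>j=1..n. r j * backlog j (queue_after h j) (Suc k)\<bar> \<le> W * real k"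
    proof (rule Wabs)
      fix j
      show "\<bar>backlog j (queue_after h j) (Suc k)\<bar> \<le> real k"
        using backlog_bounds[of j "queue_after h j" "Suc k"] supp(2)[OF that, of j] by linarith
    qed
    then show ?thesis using G[OF that] by (simp add: F_def)
  qed
  have g: "\<bar>g k h\<bar> \<le> W * 1" for k h
    unfolding g_def
  proof (rule abs_expectation_le)
    fix A assume A: "A \<in> set_pmf (L h)"
    have "\<bar>\<Sum>j=1..n. r j * (real (A j) * kappa j (queue_after h j) (Suc k))\<bar> \<le> W * 1"
      by (rule Wabs) (use L[OF A] kappa_bounds in \<open>auto intro!: mult_le_one simp: abs_mult\<close>)
    then show "\<bar>\<Sum>j=1..n. r j * real (A j) * kappa j (queue_after h j) (Suc k)\<bar> \<le> W * 1"
      by (simp add: mult.assoc)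
  qed
  have one: "measure_pmf.expectation (S h) (\<lambda>p. F (Suc k) (h @ [p])) = F k h + g k h"
    if h: "h \<in> set_pmf (R k)" and k: "k < T" for h k
  proof -
    let ?Q = "queue_after h"
    let ?D = "W * 1 + W * real (Suc k)"
    define f where "f A Q' = (\<Sum>j=1..n. r j * real (A j)) - (\<Sum>j=1..n. r j * backlog j (Q' j) (Suc
        (Suc k)))"
      for A Q' :: "nat \<Rightarrow> nat"
    have bb: "\<bar>\<Sum>j=1..n. r j * backlog j (Q' j) (Suc (Suc k))\<bar> \<le> W * real (Suc k)"
      if A: "A \<in> set_pmf (L h)" and Q': "Q' \<in> set_pmf (serve_pmf (\<lambda>j. ?Q j + A j))" for A Q'
    proof (rule Wabs)
      fix j
      have "Q' j \<le> Suc k" using serve_le[OF Q', of j] L[OF A, of j] supp(2)[OF h, of j] by linarith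
      then show "\<bar>backlog j (Q' j) (Suc (Suc k))\<bar> \<le> real (Suc k)"
        using backlog_bounds[of j "Q' j" "Suc (Suc k)"] by linarith
    qed
    have fb: "\<bar>f A Q'\<bar> \<le> ?D"
      if A: "A \<in> set_pmf (L h)" and Q': "Q' \<in> set_pmf (serve_pmf (\<lambda>j. ?Q j + A j))" for A Q'
    proof -
      have "\<bar>\<Sum>j=1..n. r j * real (A j)\<bar> \<le> W * 1"
        by (rule Wabs) (use L[OF A] in auto)
      then show ?thesis using bb[OF that] by (simp add: f_def)
    qed
    have "measure_pmf.expectation (S h) (\<lambda>p. F (Suc k) (h @ [p]))
        = measure_pmf.expectation (S h) (\<lambda>p. G h + f (joins p) (next_queue p))"
      by (simp add: F_def G_def f_def algebra_simps)
    also have "\<dots> = measure_pmf.expectation (map_pmf (\<lambda>p. (joins p, next_queue p)) (S h)) (\<lambda>(A,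
        Q'). G h + f A Q')"
      by (simp add: case_prod_unfold)
    also have "\<dots> = measure_pmf.expectation (L h) (\<lambda>A. measure_pmf.expectation (serve_pmf (\<lambda>j. ?Q j
        + A j)) (\<lambda>Q'. G h + f A Q'))"
    proof -
      have "\<bar>G h + f A Q'\<bar> \<le> \<bar>G h\<bar> + ?D"
        if "A \<in> set_pmf (L h)" "Q' \<in> set_pmf (serve_pmf (\<lambda>j. ?Q j + A j))" for A Q'
        using fb[OF that] by linarith
      then show ?thesis unfolding step
        by (subst expectation_bind_pmf[where C="\<bar>G h\<bar> + ?D"]) (auto simp: map_pmf_def[symmetric])
    qed
    also have "\<dots> = measure_pmf.expectation (L h)
        (\<lambda>A. F k h + (\<Sum>j=1..n. r j * real (A j) * kappa j (?Q j) (Suc k)))"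
    proof (rule expectation_cong_pmf)
      fix A assume A: "A \<in> set_pmf (L h)"
      let ?S = "serve_pmf (\<lambda>j. ?Q j + A j)"
      have bq: "integrable (measure_pmf ?S) (\<lambda>Q'. backlog j (Q' j) (Suc (Suc k)))" for j
      proof (rule integrable_pmf_bounded)
        fix Q' assume Q': "Q' \<in> set_pmf ?S"
        show "\<bar>backlog j (Q' j) (Suc (Suc k))\<bar> \<le> real (?Q j + A j)"
          using backlog_bounds[of j "Q' j" "Suc (Suc k)"] serve_le[OF Q', of j] by linarith
      qed
      have "measure_pmf.expectation ?S (\<lambda>Q'. G h + f A Q')
          = G h + (\<Sum>j=1..n. r j * real (A j))
            - (\<Sum>j=1..n. r j * measure_pmf.expectation ?S (\<lambda>Q'. backlog j (Q' j) (Suc (Suc k))))"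
        unfolding f_def using bq
        by (subst Bochner_Integration.integral_add Bochner_Integration.integral_diff
            Bochner_Integration.integral_sum
             | simp)+
      also have "\<dots> = G h + (\<Sum>j=1..n. r j * real (A j)) - (\<Sum>j=1..n. r j * backlog j (?Q j + A j)
          (Suc k))"
        using k by (simp add: backlog_serve)
      also have "\<dots> = F k h + (\<Sum>j=1..n. r j * real (A j) * kappa j (?Q j) (Suc k))"
      proof -
        \<comment> \<open>A join earns \<open>r j\<close> and raises the weighted backlog by
          \<open>r j * (1 - kappa)\<close>, leaving \<open>r j * kappa\<close>.\<close>
        have "r j * real (A j) - r j * backlog j (?Q j + A j) (Suc k)
           = r j * real (A j) * kappa j (?Q j) (Suc k) - r j * backlog j (?Q j) (Suc k)" for j
        proof -
          have "A j = 0 \<or> A j = 1" using L[OF A, of j] by auto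
          then show ?thesis by (auto simp: backlog_Suc algebra_simps)
        qed
        then have "(\<Sum>j=1..n. r j * real (A j)) - (\<Sum>j=1..n. r j * backlog j (?Q j + A j) (Suc k))
          = (\<Sum>j=1..n. r j * real (A j) * kappa j (?Q j) (Suc k)) - (\<Sum>j=1..n. r j * backlog j (?Q
              j) (Suc k))"
          by (simp only: sum_subtractf[symmetric])
        then show ?thesis unfolding F_def by linarith
      qed
      finally show "measure_pmf.expectation ?S (\<lambda>Q'. G h + f A Q')
        = F k h + (\<Sum>j=1..n. r j * real (A j) * kappa j (?Q j) (Suc k))" .
    qed
    also have "\<dots> = F k h + g k h"
    proof -
      have "\<bar>\<Sum>j=1..n. r j * (real (A j) * kappa j (?Q j) (Suc k))\<bar> \<le> W * 1" if A: "A \<in> set_pmf (L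
          h)" for A
        by (rule Wabs) (use L[OF A] kappa_bounds in \<open>auto intro!: mult_le_one simp: abs_mult\<close>)
      then show ?thesis unfolding g_def
        by (subst Bochner_Integration.integral_add) (auto intro!: integrable_pmf_bounded[where
            C="W * 1"] simp: mult.assoc)
    qed
    finally show ?thesis .
  qed
  have "k \<le> T \<Longrightarrow> measure_pmf.expectation (R k) (F k) = (\<Sum>i<k. measure_pmf.expectation (R i) (g i))"
      for k
  proof (induction k)
    case 0
    have "backlog j 0 t = 0" for j t using backlog_bounds[of j 0 t] by simp
    then show ?case by (simp add: R0 F_def G_def)
  next
    case (Suc k)
    have "measure_pmf.expectation (R (Suc k)) (F (Suc k))
        = measure_pmf.expectation (R k) (\<lambda>h. measure_pmf.expectation (S h) (\<lambda>p. F (Suc k) (h @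
            [p])))"
    proof -
      have "\<bar>F (Suc k) (h @ [p])\<bar> \<le> W * real (Suc k) + W * real (Suc k)"
        if "h \<in> set_pmf (R k)" "p \<in> set_pmf (S h)" for h p
        by (rule F) (use that in \<open>auto simp: RS\<close>)
      then show ?thesis unfolding RS
        by (subst expectation_bind_pmf[where C="W * real (Suc k) + W * real (Suc k)"])
           (auto simp: map_pmf_def[symmetric])
    qed
    also have "\<dots> = measure_pmf.expectation (R k) (\<lambda>h. F k h + g k h)"
      by (rule expectation_cong_pmf, rule one) (use Suc.prems in auto)
    also have "\<dots> = measure_pmf.expectation (R k) (F k) + measure_pmf.expectation (R k) (g k)"
      by (rule Bochner_Integration.integral_add)
         (auto intro: integrable_pmf_bounded[OF F] integrable_pmf_bounded[OF g])
    finally show ?case using Suc by simp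
  qed
  from this[of T] have "measure_pmf.expectation (R T) (F T) = (\<Sum>k<T. measure_pmf.expectation (R k)
      (g k))" by simp
  moreover have "F T = net_revenue" by (auto simp: F_def G_def net_revenue_def backlog_end)
  ultimately show ?thesis by (simp add: g_def[abs_def])
qed

section \<open>The linear program bounds every policy\<close>

lemma K_serve:
  assumes "j \<in> {1..n}"
  shows "measure_pmf.expectation (serve_pmf Qp) (\<lambda>Q'. of_bool (Q' j = q')) = K j (Qp j) q'"
proof -
  have "measure_pmf.expectation (serve_pmf Qp) (\<lambda>Q'. of_bool (Q' j = q') :: real)
      = measure_pmf.expectation (map_pmf (\<lambda>Q'. Q' j) (serve_pmf Qp)) (\<lambda>q. of_bool (q = q'))"
    by simp
  then show ?thesis
    by (simp only: serve_component[OF assms] K_def) (simp only: expectation_pmf_of_bool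
        measure_map_pmf vimage_def mem_Collect_eq)
qed

lemma expectation_join:
  fixes f :: "nat \<Rightarrow> real"
  assumes "rec = None \<or> rec \<in> Some ` {1..n}"
  shows "measure_pmf.expectation (join_pmf Q rec) (\<lambda>A. f (A j))
    = f 0 + of_bool (rec = Some j) * (a j (Q j) * (f 1 - f 0))"
proof (cases rec)
  case (Some i)
  then have "i \<in> {1..n}" using assms by auto
  then show ?thesis using join_prob[of i "Q i"] Some
    by (auto simp: join_pmf_def algebra_simps)
qed (simp add: join_pmf_def)

lemma join_le: "A \<in> set_pmf (join_pmf Q rec) \<Longrightarrow> A j \<le> 1"
  by (auto simp: join_pmf_def split: option.splits)

definition policy_join :: "policy \<Rightarrow> policy_period list \<Rightarrow> (nat \<Rightarrow> nat) pmf" where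
  "policy_join \<pi> h = do {
     arr \<leftarrow> bernoulli_pmf (lam (Suc (length h)));
     (s, rec) \<leftarrow> \<pi> h arr;
     join_pmf (queue_after h) rec
   }"

text \<open>Conditional on an arrival, because \<open>abar\<close> already carries the factor
  \<open>lam t\<close>.\<close>

definition recommend_prob :: "policy \<Rightarrow> policy_period list \<Rightarrow> nat \<Rightarrow> real" where
  "recommend_prob \<pi> h j = measure_pmf.prob (\<pi> h True) {d. snd d = Some j}"

lemma policy_step_joins:
  "map_pmf (\<lambda>p. (joins p, next_queue p)) (policy_step \<pi> h)
   = do {A \<leftarrow> policy_join \<pi> h; Q' \<leftarrow> serve_pmf (\<lambda>j. queue_after h j + A j); return_pmf (A, Q')}"
  by (simp add: policy_step_def policy_join_def Let_def map_bind_pmf bind_assoc_pmf case_prod_unfold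
      bind_return_pmf)

lemma policy_join_le: "A \<in> set_pmf (policy_join \<pi> h) \<Longrightarrow> A j \<le> 1"
  using join_le by (auto simp: policy_join_def)

lemma expectation_policy_join:
  fixes f :: "nat \<Rightarrow> real"
  assumes pi: "\<pi> \<in> policies" and len: "length h < T"
  shows "measure_pmf.expectation (policy_join \<pi> h) (\<lambda>A. f (A j))
    = f 0 + abar j (Suc (length h)) (queue_after h j) * recommend_prob \<pi> h j * (f 1 - f 0)"
proof -
  let ?Q = "queue_after h" and ?t = "Suc (length h)"
  define C where "C = \<bar>f 0\<bar> + \<bar>f 1\<bar>"
  have "Suc (length h) \<in> {1..T}" using len by auto
  from arrival_prob[OF this] have lam: "0 \<le> lam ?t" "lam ?t \<le> 1" by auto
  have C: "\<bar>f (A j)\<bar> \<le> C" if "A j \<le> 1" for A :: "nat \<Rightarrow> nat"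
  proof -
    have "A j = 0 \<or> A j = 1" using that by auto
    then show ?thesis by (auto simp: C_def)
  qed
  have inner: "measure_pmf.expectation (\<pi> h arr \<bind> (\<lambda>(s, rec). join_pmf ?Q rec)) (\<lambda>A. f (A j))
    = f 0 + measure_pmf.prob (\<pi> h arr) {d. snd d = Some j} * (a j (?Q j) * (f 1 - f 0))" for arr
  proof -
    have "measure_pmf.expectation (\<pi> h arr \<bind> (\<lambda>(s, rec). join_pmf ?Q rec)) (\<lambda>A. f (A j))
      = measure_pmf.expectation (\<pi> h arr) (\<lambda>d. measure_pmf.expectation (join_pmf ?Q (snd d)) (\<lambda>A.
          f (A j)))"
      by (subst expectation_bind_pmf[where C=C]) (auto simp: case_prod_unfold intro: C join_le)
    also have "\<dots> = measure_pmf.expectation (\<pi> h arr)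
        (\<lambda>d. f 0 + of_bool (snd d = Some j) * (a j (?Q j) * (f 1 - f 0)))"
    proof (rule expectation_cong_pmf, rule expectation_join)
      fix d assume "d \<in> set_pmf (\<pi> h arr)"
      then show "snd d = None \<or> snd d \<in> Some ` {1..n}"
        using pi unfolding policies_def by (fastforce simp: case_prod_unfold)
    qed
    also have "\<dots> = f 0 + measure_pmf.prob (\<pi> h arr) {d. snd d = Some j} * (a j (?Q j) * (f 1 - f
        0))"
      by (subst Bochner_Integration.integral_add)
         (auto intro!: integrable_pmf_bounded[where C=1] simp: expectation_pmf_of_bool)
    finally show ?thesis .
  qed
  \<comment> \<open>Membership in \<open>policies\<close> rules out recommendations without an
    arrival, so only the branch \<open>True\<close> contributes.\<close>
  have "measure_pmf.prob (\<pi> h False) {d. snd d = Some j} = 0"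
    using pi by (fastforce simp: policies_def measure_pmf_zero_iff)
  then show ?thesis
    using lam unfolding policy_join_def
    by (subst expectation_bind_pmf[where C=C])
       (auto simp: inner recommend_prob_def abar_def algebra_simps intro: C join_le)
qed

lemma policy_run_revenue:
  "policy_revenue \<pi> = (\<Sum>k<T. measure_pmf.expectation (policy_run \<pi> k)
      (\<lambda>h. measure_pmf.expectation (policy_join \<pi> h)
        (\<lambda>A. \<Sum>j=1..n. r j * real (A j) * kappa j (queue_after h j) (Suc k))))"
  unfolding policy_revenue_def
  by (rule run_revenue[where S="policy_step \<pi>"])
     (use policy_join_le in \<open>auto simp: policy_step_joins\<close>)

lemma policy_run_bounds:
  assumes "h \<in> set_pmf (policy_run \<pi> k)"
  shows "length h = k" "queue_after h j \<le> k"
proof -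
  show "length h = k" "queue_after h j \<le> k"
    by (rule run_queue_le[where R="policy_run \<pi>" and S="policy_step \<pi>" and L="policy_join \<pi>"],
        simp, simp, rule policy_step_joins, erule policy_join_le, rule assms)+
qed

lemma recommend_prob_bounds: "0 \<le> recommend_prob \<pi> h j" "recommend_prob \<pi> h j \<le> 1"
  by (auto simp: recommend_prob_def)

lemma sum_recommend_prob: "(\<Sum>j=1..n. recommend_prob \<pi> h j) \<le> 1"
proof -
  have "(\<Sum>j=1..n. recommend_prob \<pi> h j)
      = measure_pmf.prob (\<pi> h True) (\<Union>j\<in>{1..n}. {d. snd d = Some j})"
    unfolding recommend_prob_def
    by (subst measure_pmf.finite_measure_finite_Union) (auto simp: disjoint_family_on_def)
  then show ?thesis by simp
qed

section \<open>Occupation measure of a policy; the state of period \<open>t\<close> is read off a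
  history of \<open>t - 1\<close> periods\<close>

definition policy_y :: "policy \<Rightarrow> nat \<Rightarrow> nat \<Rightarrow> nat \<Rightarrow> real" where
  "policy_y \<pi> j q t = measure_pmf.expectation (policy_run \<pi> (t - 1)) (\<lambda>h. of_bool (queue_after h j
      = q))"

definition policy_x :: "policy \<Rightarrow> nat \<Rightarrow> nat \<Rightarrow> nat \<Rightarrow> real" where
  "policy_x \<pi> j q t = measure_pmf.expectation (policy_run \<pi> (t - 1))
     (\<lambda>h. of_bool (queue_after h j = q) * recommend_prob \<pi> h j)"

lemma policy_integrable [simp]:
  "integrable (measure_pmf p) (\<lambda>h. of_bool (queue_after h j = q) :: real)"
  "integrable (measure_pmf p) (\<lambda>h. of_bool (queue_after h j = q) * recommend_prob \<pi> h j)"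
  using recommend_prob_bounds by (auto intro!: integrable_pmf_bounded[where C=1])

text \<open>The recommendation probability may depend on the whole history, but it enters the
  conditional transition probability linearly. Averaging over histories with equal queue length
  therefore leaves only \<open>policy_x\<close>.\<close>

lemma policy_flow:
  assumes pi: "\<pi> \<in> policies" and j: "j \<in> {1..n}" and t: "t \<in> {1..T}"
  shows "policy_y \<pi> j q' (t + 1) = (\<Sum>q=0..t-1. (policy_y \<pi> j q t - abar j t q * policy_x \<pi> j q t)
      * K j q q'
                     + abar j t q * policy_x \<pi> j q t * K j (q+1) q')"
proof -
  define k where "k = t - 1"
  have k: "t = Suc k" "k < T" using t by (auto simp: k_def)
  let ?R = "policy_run \<pi> k"
  define H where "H h q = (1 - abar j t q * recommend_prob \<pi> h j) * K j q q'
      + abar j t q * recommend_prob \<pi> h j * K j (q+1) q'" for h q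
  have "policy_y \<pi> j q' (t + 1)
     = measure_pmf.expectation (policy_run \<pi> (Suc k)) (\<lambda>h. of_bool (queue_after h j = q'))"
    by (simp add: policy_y_def k(1))
  also have "\<dots> = measure_pmf.expectation ?R (\<lambda>h. measure_pmf.expectation (policy_step \<pi> h) (\<lambda>p.
      of_bool (next_queue p j = q')))"
    unfolding policy_run.simps
    by (subst expectation_bind_pmf[where C=1])
       (simp_all add: map_pmf_def[symmetric])
  also have "\<dots> = measure_pmf.expectation ?R (\<lambda>h. H h (queue_after h j))"
  proof (rule expectation_cong_pmf)
    fix h assume h: "h \<in> set_pmf ?R"
    have "measure_pmf.expectation (policy_step \<pi> h) (\<lambda>p. of_bool (next_queue p j = q') :: real)
      = measure_pmf.expectation (map_pmf (\<lambda>p. (joins p, next_queue p)) (policy_step \<pi> h)) (\<lambda>(A,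
          Q'). of_bool (Q' j = q'))"
      by (simp add: case_prod_unfold)
    also have "\<dots> = measure_pmf.expectation (policy_join \<pi> h) (\<lambda>A. K j (queue_after h j + A j) q')"
      unfolding policy_step_joins
      by (subst expectation_bind_pmf[where C=1]) (auto simp: map_pmf_def[symmetric] K_serve[OF j])
    also have "\<dots> = H h (queue_after h j)"
      using expectation_policy_join[OF pi, of h "\<lambda>x. K j (queue_after h j + x) q'" j]
          policy_run_bounds(1)[OF h] k
      by (simp add: H_def algebra_simps)
    finally show "measure_pmf.expectation (policy_step \<pi> h) (\<lambda>p. of_bool (next_queue p j = q')) =
        H h (queue_after h j)" .
  qed
  \<comment> \<open>After \<open>k\<close> periods the queue is at most \<open>k\<close>, so the sum
    over \<open>0..k\<close> catches its value and separates the state from the history-dependent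
    factor.\<close>
  also have "\<dots> = measure_pmf.expectation ?R (\<lambda>h. \<Sum>q=0..k. of_bool (queue_after h j = q) * H h q)"
    by (rule expectation_cong_pmf) (use policy_run_bounds(2) in \<open>simp add: sum_of_bool_eq\<close>)
  also have "\<dots> = measure_pmf.expectation ?R (\<lambda>h. \<Sum>q=0..k.
       of_bool (queue_after h j = q) * K j q q'
       + of_bool (queue_after h j = q) * recommend_prob \<pi> h j * (abar j t q * (K j (q + 1) q' - K
           j q q')))"
    by (simp add: H_def algebra_simps)
  also have "\<dots> = (\<Sum>q=0..k. policy_y \<pi> j q t * K j q q' + policy_x \<pi> j q t * (abar j t q * (K j (q
      + 1) q' - K j q q')))"
    by (subst Bochner_Integration.integral_sum)
       (simp_all add: policy_y_def policy_x_def k(1))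
  finally show ?thesis by (simp add: k(1) algebra_simps)
qed

lemma policy_feasible:
  assumes pi: "\<pi> \<in> policies"
  shows "molp_feasible (policy_x \<pi>) (policy_y \<pi>)"
  unfolding molp_feasible_def
proof (intro conjI ballI allI impI)
  fix j q t
  show "0 \<le> policy_x \<pi> j q t" "0 \<le> policy_y \<pi> j q t"
    unfolding policy_x_def policy_y_def
    by (rule Bochner_Integration.integral_nonneg, simp add: recommend_prob_bounds)+
  show "policy_x \<pi> j q t \<le> policy_y \<pi> j q t"
    unfolding policy_x_def policy_y_def
    by (rule integral_mono) (simp_all add: recommend_prob_bounds)
next
  fix t assume t: "t \<in> {1..T}"
  have "(\<Sum>j=1..n. \<Sum>q=0..t-1. policy_x \<pi> j q t)
     = measure_pmf.expectation (policy_run \<pi> (t - 1))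
        (\<lambda>h. \<Sum>j=1..n. \<Sum>q=0..t-1. of_bool (queue_after h j = q) * recommend_prob \<pi> h j)"
    unfolding policy_x_def
    by (simp only: Bochner_Integration.integral_sum Bochner_Integration.integrable_sum
        policy_integrable)
  also have "\<dots> \<le> 1"
  proof -
    \<comment> \<open>For a fixed history each inner sum keeps a single term, which leaves the total
      recommendation probability.\<close>
    have 1: "(\<Sum>j=1..n. \<Sum>q=0..t-1. of_bool (queue_after h j = q) * recommend_prob \<pi> h j) \<le> 1"
      if "h \<in> set_pmf (policy_run \<pi> (t - 1))" for h
      using sum_recommend_prob[of \<pi> h] policy_run_bounds(2)[OF that]
      by (simp add: sum_of_bool_eq)
    show ?thesis
    proof (rule measure_pmf.integral_le_const)
      show "integrable (measure_pmf (policy_run \<pi> (t - 1)))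
          (\<lambda>h. \<Sum>j=1..n. \<Sum>q=0..t-1. of_bool (queue_after h j = q) * recommend_prob \<pi> h j)"
        by (intro Bochner_Integration.integrable_sum policy_integrable)
    qed (use 1 in \<open>unfold AE_measure_pmf_iff, blast\<close>)
  qed
  finally show "(\<Sum>j=1..n. \<Sum>q=0..t-1. policy_x \<pi> j q t) \<le> 1" .
next
  fix j t q' assume "j \<in> {1..n}" "t \<in> {1..T}"
  then show "policy_y \<pi> j q' (t + 1) = (\<Sum>q=0..t-1. (policy_y \<pi> j q t - abar j t q * policy_x \<pi> j q
      t) * K j q q'
                     + abar j t q * policy_x \<pi> j q t * K j (q+1) q')"
    by (rule policy_flow[OF pi])
qed (simp_all add: policy_y_def)

lemma policy_objective:
  assumes pi: "\<pi> \<in> policies"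
  shows "molp_objective (policy_x \<pi>) = policy_revenue \<pi>"
proof -
  have "measure_pmf.expectation (policy_run \<pi> k) (\<lambda>h. measure_pmf.expectation (policy_join \<pi> h)
        (\<lambda>A. \<Sum>j=1..n. r j * real (A j) * kappa j (queue_after h j) (Suc k)))
    = (\<Sum>j=1..n. \<Sum>q=0..k. r j * kappa j q (Suc k) * abar j (Suc k) q * policy_x \<pi> j q (Suc k))"
    (is "?lhs = ?rhs") if k: "k < T" for k
  proof -
    have "?lhs = measure_pmf.expectation (policy_run \<pi> k) (\<lambda>h. \<Sum>j=1..n. \<Sum>q=0..k.
        of_bool (queue_after h j = q) * recommend_prob \<pi> h j * (r j * kappa j q (Suc k) * abar j
            (Suc k) q))"
    proof (rule expectation_cong_pmf)
      fix h assume h: "h \<in> set_pmf (policy_run \<pi> k)"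
      note b = policy_run_bounds[OF h]
      have int: "integrable (measure_pmf (policy_join \<pi> h)) (\<lambda>A. real (A j))" for j
        by (rule integrable_pmf_bounded[where C=1]) (use policy_join_le in auto)
      have "measure_pmf.expectation (policy_join \<pi> h)
          (\<lambda>A. \<Sum>j=1..n. r j * real (A j) * kappa j (queue_after h j) (Suc k))
        = (\<Sum>j=1..n. r j * measure_pmf.expectation (policy_join \<pi> h) (\<lambda>A. real (A j)) * kappa j
            (queue_after h j) (Suc k))"
        using int by (subst Bochner_Integration.integral_sum) auto
      also have "\<dots> = (\<Sum>j=1..n. \<Sum>q=0..k.
        of_bool (queue_after h j = q) * (recommend_prob \<pi> h j * (r j * kappa j q (Suc k) * abar j
            (Suc k) q)))"
      proof (rule sum.cong[OF refl])
        fix j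
        have "measure_pmf.expectation (policy_join \<pi> h) (\<lambda>A. real (A j))
          = abar j (Suc k) (queue_after h j) * recommend_prob \<pi> h j"
          using expectation_policy_join[OF pi, of h real j] b k by simp
        then show "r j * measure_pmf.expectation (policy_join \<pi> h) (\<lambda>A. real (A j)) * kappa j
            (queue_after h j) (Suc k)
          = (\<Sum>q=0..k. of_bool (queue_after h j = q) * (recommend_prob \<pi> h j * (r j * kappa j q
              (Suc k) * abar j (Suc k) q)))"
          using b(2) by (simp add: sum_of_bool_eq)
      qed
      finally show "measure_pmf.expectation (policy_join \<pi> h)
          (\<lambda>A. \<Sum>j=1..n. r j * real (A j) * kappa j (queue_after h j) (Suc k)) = (\<Sum>j=1..n. \<Sum>q=0..k.
        of_bool (queue_after h j = q) * recommend_prob \<pi> h j * (r j * kappa j q (Suc k) * abar j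
            (Suc k) q))"
        by (simp add: mult.assoc)
    qed
    also have "\<dots> = (\<Sum>j=1..n. \<Sum>q=0..k. policy_x \<pi> j q (Suc k) * (r j * kappa j q (Suc k) * abar j
        (Suc k) q))"
      unfolding policy_x_def
      by (simp only: Bochner_Integration.integral_sum Bochner_Integration.integrable_sum
          policy_integrable
          Bochner_Integration.integral_mult_left_zero integrable_mult_left diff_Suc_1)
    finally show ?thesis by (simp add: mult_ac)
  qed
  then have "policy_revenue \<pi> = (\<Sum>k<T. \<Sum>j=1..n. \<Sum>q=0..Suc k - 1. r j * kappa j q (Suc k) * abar j
      (Suc k) q * policy_x \<pi> j q (Suc k))"
    by (simp add: policy_run_revenue)
  also have "\<dots> = molp_objective (policy_x \<pi>)"
    unfolding molp_objective_def by (rule sum.reindex_bij_witness[where i="\<lambda>t. t - 1" and j=Suc])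
        auto
  finally show ?thesis ..
qed

lemma OPT_le_molp:
  assumes "molp_optimal x y"
  shows "OPT \<le> molp_objective x"
  unfolding OPT_def
proof (rule cSUP_least[OF policies_nonempty])
  fix \<pi> assume pi: "\<pi> \<in> policies"
  show "policy_revenue \<pi> \<le> molp_objective x"
    using assms policy_feasible[OF pi] policy_objective[OF pi] by (auto simp: molp_optimal_def)
qed

section \<open>Support of a run of the algorithm\<close>

text \<open>Recognising the weights as a \<open>cond_pmf\<close> yields nonnegativity and total mass
  1 as soon as some capacity of at least \<open>qp\<close> is possible.\<close>

lemma bhat_weight_eq:
  assumes "set_pmf (xi j) \<inter> {qp..} \<noteq> {}"
  shows "bhat_weight j qp = pmf (cond_pmf (xi j) {qp..})"
  using assms by (auto simp: bhat_weight_def pmf_cond fun_eq_iff)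

lemma bhat_weight_valid:
  assumes "set_pmf (xi j) \<inter> {qp..} \<noteq> {}"
  shows "0 < measure_pmf.prob (xi j) {qp..}" "0 \<le> bhat_weight j qp b" "bhat_weight j qp sums 1"
proof -
  show "0 < measure_pmf.prob (xi j) {qp..}"
    using assms by (simp add: measure_measure_pmf_not_zero order.not_eq_order_implies_strict
        zero_less_measure_iff)
  show "0 \<le> bhat_weight j qp b" by (simp add: bhat_weight_eq[OF assms])
  have "pmf p sums 1" for p :: "nat pmf"
    using sums_infsetsum_nat'[OF pmf_abs_summable[of p UNIV]] by (simp add: infsetsum_pmf_eq_1)
  then show "bhat_weight j qp sums 1" by (simp add: bhat_weight_eq[OF assms])
qed

text \<open>Both branches condition the capacity on the observed value \<open>qp - b\<close>: a
  positive value determines \<open>b\<close>, and the value 0 reveals only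
  \<open>b \<ge> qp\<close>.\<close>

lemma bhat_pmf_eq:
  assumes "b \<in> set_pmf (xi j)"
  shows "bhat_pmf j qp (qp - b) = cond_pmf (xi j) {b'. qp - b = qp - b'}"
proof (cases "b < qp")
  case True
  then have "{b'. qp - b = qp - b'} = {b}" by auto
  then show ?thesis using True assms by (simp add: bhat_pmf_def cond_pmf_singleton)
next
  case False
  then have "{b'. qp - b = qp - b'} = {qp..}" by auto
  moreover have "set_pmf (xi j) \<inter> {qp..} \<noteq> {}" using False assms by auto
  moreover have "embed_pmf (pmf p) = p" for p :: "nat pmf"
    using type_definition.Rep_inverse[OF td_pmf_embed_pmf] .
  ultimately show ?thesis using False by (simp add: bhat_pmf_def bhat_weight_eq)
qed

text \<open>Resampling from the conditional law given an observation restores the original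
  law.\<close>

lemma bhat_resample: "xi j \<bind> (\<lambda>b. bhat_pmf j qp (qp - b)) = xi j"
proof -
  have "xi j \<bind> (\<lambda>b. bhat_pmf j qp (qp - b)) = xi j \<bind> (\<lambda>b. cond_pmf (xi j) {b'. qp - b = qp - b'})"
    by (rule bind_pmf_cong) (auto simp: bhat_pmf_eq)
  also have "\<dots> = xi j"
    by (rule bind_cond_pmf_cancel) (auto simp: eq_commute)
  finally show ?thesis .
qed

text \<open>The right-hand side does not mention \<open>Qp\<close>: averaged over service, the
  virtual capacities are fresh draws that carry no information about queues or joins.\<close>

lemma serve_bhat:
  "serve_pmf Qp \<bind> (\<lambda>Q'. Pi_pmf {1..n} 0 (\<lambda>j. bhat_pmf j (Qp j) (Q' j))) = Pi_pmf {1..n} 0 xi"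
proof -
  have "serve_pmf Qp \<bind> (\<lambda>Q'. Pi_pmf {1..n} 0 (\<lambda>j. bhat_pmf j (Qp j) (Q' j)))
     = Pi_pmf {1..n} 0 (\<lambda>j. xi j \<bind> (\<lambda>b. bhat_pmf j (Qp j) (Qp j - b)))"
    by (subst Pi_pmf_bind[where d'=0]) (simp_all add: serve_pmf_def bind_map_pmf)
  then show ?thesis by (simp add: bhat_resample)
qed

section \<open>Selection and pathwise domination\<close>

definition lpga_selected :: "(nat set \<Rightarrow> nat) \<Rightarrow> nat \<Rightarrow> (nat \<Rightarrow> nat) \<Rightarrow> (nat \<Rightarrow> bool) \<Rightarrow> nat option" where
  "lpga_selected pick t Q I = (let S = {j \<in> {1..n}. I j} in
     if S = {} then None else Some (pick (argmax_set t Q S)))"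

lemma argmax_set_nonempty:
  assumes "finite S" "S \<noteq> {}"
  shows "argmax_set t Q S \<noteq> {}"
proof -
  let ?f = "\<lambda>j. r j * abar j t (Q j) * kappa j (Q j) t"
  obtain j where "j \<in> S" "Max (?f ` S) = ?f j"
    using Max_in[of "?f ` S"] assms by fastforce
  moreover have "?f k \<le> Max (?f ` S)" if "k \<in> S" for k using assms that by simp
  ultimately have "j \<in> argmax_set t Q S" by (auto simp: argmax_set_def)
  then show ?thesis by blast
qed

lemma lpga_selected_SomeD:
  assumes "tie_breaking pick" "lpga_selected pick t Q I = Some m"
  shows "m \<in> {1..n}" "I m" "m \<in> argmax_set t Q {j \<in> {1..n}. I j}"
proof -
  let ?S = "{j \<in> {1..n}. I j}"
  have S: "?S \<noteq> {}" "m = pick (argmax_set t Q ?S)"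
    using assms(2) by (auto simp: lpga_selected_def Let_def split: if_splits)
  have ne: "argmax_set t Q ?S \<noteq> {}" by (rule argmax_set_nonempty) (use S in auto)
  have sub: "argmax_set t Q ?S \<subseteq> ?S" by (auto simp: argmax_set_def)
  show "m \<in> argmax_set t Q ?S"
  proof -
    have "argmax_set t Q ?S \<subseteq> {1..n}" using sub by blast
    with assms(1) ne have "pick (argmax_set t Q ?S) \<in> argmax_set t Q ?S" unfolding
        tie_breaking_def by blast
    then show ?thesis using S(2) by simp
  qed
  with sub show "m \<in> {1..n}" "I m" by auto
qed

definition lpga_join :: "(nat \<Rightarrow> nat \<Rightarrow> nat \<Rightarrow> real) \<Rightarrow> (nat \<Rightarrow> nat \<Rightarrow> nat \<Rightarrow> real)
    \<Rightarrow> (nat set \<Rightarrow> nat) \<Rightarrow> lpga_period list \<Rightarrow> (nat \<Rightarrow> nat) pmf" where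
  "lpga_join x y pick h = do {
     I \<leftarrow> Pi_pmf {1..n} False (\<lambda>j. bernoulli_pmf (w x y (length h + 1) (queue_after h)
         (vqueue_after h) j));
     arr \<leftarrow> bernoulli_pmf (lam (length h + 1));
     join_pmf (queue_after h) (if arr then lpga_selected pick (length h + 1) (queue_after h) I
         else None)
   }"

definition vjoin_pmf :: "nat \<Rightarrow> (nat \<Rightarrow> nat) \<Rightarrow> (nat \<Rightarrow> bool) \<Rightarrow> nat option \<Rightarrow> (nat \<Rightarrow> nat) \<Rightarrow> (nat \<Rightarrow> nat)
    pmf" where
  "vjoin_pmf t Q I J A = Pi_pmf {1..n} 0 (\<lambda>k.
        if J = Some k then return_pmf (A k)
        else if k \<in> {j \<in> {1..n}. I j} then map_pmf of_bool (bernoulli_pmf (abar k t (Q k)))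
        else return_pmf 0)"

lemma lpga_step_alt:
  "lpga_step x y pick h = do {
     I \<leftarrow> Pi_pmf {1..n} False (\<lambda>j. bernoulli_pmf (w x y (length h + 1) (queue_after h)
         (vqueue_after h) j));
     arr \<leftarrow> bernoulli_pmf (lam (length h + 1));
     A \<leftarrow> join_pmf (queue_after h) (if arr then lpga_selected pick (length h + 1) (queue_after h) I
         else None);
     Q' \<leftarrow> serve_pmf (\<lambda>j. queue_after h j + A j);
     Ah \<leftarrow> vjoin_pmf (length h + 1) (queue_after h) I (lpga_selected pick (length h + 1)
         (queue_after h) I) A;
     Bh \<leftarrow> Pi_pmf {1..n} 0 (\<lambda>j. bhat_pmf j (queue_after h j + A j) (Q' j));
     return_pmf \<lparr>queue = queue_after h, arrived = arr,
                 recommended = (if arr then lpga_selected pick (length h + 1) (queue_after h) I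
                     else None),
                 joins = A, next_queue = Q',
                 vqueue = vqueue_after h, sampled = {j \<in> {1..n}. I j},
                 selected = lpga_selected pick (length h + 1) (queue_after h) I, vjoins = Ah,
                     vservice = Bh,
                 next_vqueue = (\<lambda>j. vqueue_after h j + Ah j - Bh j)\<rparr>
   }"
  unfolding lpga_step_def lpga_selected_def vjoin_pmf_def Let_def ..

lemma lpga_step_joins:
  "map_pmf (\<lambda>p. (joins p, next_queue p)) (lpga_step x y pick h)
   = do {A \<leftarrow> lpga_join x y pick h; Q' \<leftarrow> serve_pmf (\<lambda>j. queue_after h j + A j); return_pmf (A, Q')}"
  by (simp add: lpga_step_alt lpga_join_def map_bind_pmf bind_assoc_pmf)

lemma lpga_join_le: "A \<in> set_pmf (lpga_join x y pick h) \<Longrightarrow> A j \<le> 1"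
  using join_le by (auto simp: lpga_join_def)

lemma vqueue_after_simps [simp]:
  "vqueue_after [] = (\<lambda>_. 0)" "vqueue_after (h @ [p]) = next_vqueue p"
  by (auto simp: vqueue_after_def)

text \<open>Besides domination, the bound by \<open>length h\<close> keeps virtual states within the
  index range \<open>q \<le> t - 1\<close> of the LP, and the value 0 off the services matches the
  default of \<open>Pi_pmf\<close>.\<close>

definition lpga_inv :: "lpga_period list \<Rightarrow> bool" where
  "lpga_inv h \<longleftrightarrow> (\<forall>j\<in>{1..n}. queue_after h j \<le> vqueue_after h j \<and> vqueue_after h j \<le> length h)
     \<and> (\<forall>j. j \<notin> {1..n} \<longrightarrow> vqueue_after h j = 0)"

text \<open>Domination survives a period: if the next queue is positive, the virtual capacity equals
  the number actually removed and acts on both queues; if it is 0, there is nothing to show. The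
  last claim holds because an emptied queue exhibits a sufficient capacity in the support.\<close>

lemma lpga_step_support:
  assumes tb: "tie_breaking pick" and inv: "lpga_inv h" and p: "p \<in> set_pmf (lpga_step x y pick h)"
  shows "lpga_inv (h @ [p])" "queue p = queue_after h" "vqueue p = vqueue_after h"
    "sampled p \<subseteq> {1..n}"
    "j \<in> {1..n} \<Longrightarrow> next_queue p j = 0 \<Longrightarrow> set_pmf (xi j) \<inter> {queue p j + joins p j..} \<noteq> {}"
proof -
  let ?Q = "queue_after h" and ?Qh = "vqueue_after h" and ?J = "lpga_selected pick (length h + 1)
      (queue_after h)"
  from p obtain I arr A Q' Ah Bh where
    A: "A \<in> set_pmf (join_pmf ?Q (if arr then ?J I else None))" and
    Q': "Q' \<in> set_pmf (serve_pmf (\<lambda>j. ?Q j + A j))" and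
    Ah: "Ah \<in> set_pmf (vjoin_pmf (length h + 1) ?Q I (?J I) A)" and
    Bh: "Bh \<in> set_pmf (Pi_pmf {1..n} 0 (\<lambda>j. bhat_pmf j (?Q j + A j) (Q' j)))" and
    peq: "queue p = ?Q" "vqueue p = ?Qh" "joins p = A" "next_queue p = Q'" "sampled p = {j \<in>
        {1..n}. I j}"
      "next_vqueue p = (\<lambda>j. ?Qh j + Ah j - Bh j)"
    unfolding lpga_step_alt by auto
  from Q' obtain B where B: "B \<in> set_pmf (Pi_pmf {1..n} 0 xi)" and Q'_eq: "Q' = (\<lambda>j. ?Q j + A j -
      B j)"
    by (auto simp: serve_pmf_def)
  show "queue p = ?Q" "vqueue p = ?Qh" "sampled p \<subseteq> {1..n}" using peq by auto
  show "set_pmf (xi j) \<inter> {queue p j + joins p j..} \<noteq> {}" if "j \<in> {1..n}" "next_queue p j = 0"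
    using Pi_pmf_memD(1)[OF B _ that(1)] that(2) peq Q'_eq by auto
  have A0: "A k = 0" if "?J I \<noteq> Some k" for k
    using A that by (auto simp: join_pmf_def split: option.splits if_splits)
  \<comment> \<open>The selected service copies its actual join; for every other service the actual
    join is 0.\<close>
  have Ah_in: "A k \<le> Ah k \<and> Ah k \<le> 1" if "k \<in> {1..n}" for k
    using Pi_pmf_memD(1)[OF Ah[unfolded vjoin_pmf_def] _ that] join_le[OF A, of k] A0[of k]
    by (auto split: if_splits)
  have Ah_out: "Ah k = 0" if "k \<notin> {1..n}" for k
    using Pi_pmf_memD(2)[OF Ah[unfolded vjoin_pmf_def] _ that] by simp
  have Bh_in: "Bh k = ?Q k + A k - Q' k" if "k \<in> {1..n}" "Q' k > 0" for k
    using Pi_pmf_memD(1)[OF Bh _ that(1)] that(2) by (simp add: bhat_pmf_def)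
  show "lpga_inv (h @ [p])"
    unfolding lpga_inv_def
  proof (intro conjI ballI allI impI)
    fix k assume k: "k \<in> {1..n}"
    have inv': "?Q k \<le> ?Qh k" "?Qh k \<le> length h" using inv k by (auto simp: lpga_inv_def)
    show "vqueue_after (h @ [p]) k \<le> length (h @ [p])"
    proof -
      have "?Qh k + Ah k \<le> Suc (length h)" using inv' Ah_in[OF k] by linarith
      then show ?thesis by (simp add: peq le_diff_conv)
    qed
    show "queue_after (h @ [p]) k \<le> vqueue_after (h @ [p]) k"
    proof (cases "Q' k > 0")
      case True
      have "Q' k = ?Q k + A k - Bh k" using Bh_in[OF k True] Q'_eq by simp
      moreover have "?Q k + A k \<le> ?Qh k + Ah k" using inv' Ah_in[OF k] by linarith
      ultimately show ?thesis by (simp add: peq diff_le_mono)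
    qed (simp add: peq)
  next
    fix k assume "k \<notin> {1..n}"
    then show "vqueue_after (h @ [p]) k = 0" using inv Ah_out by (simp add: peq lpga_inv_def)
  qed
qed

text \<open>Well-definedness speaks of every period of the final trajectory, so the induction
  records the facts for all prefixes.\<close>

lemma lpga_run_support:
  assumes tb: "tie_breaking pick" and "h \<in> set_pmf (lpga_run x y pick k)"
  shows "length h = k \<and> lpga_inv h \<and> (\<forall>i<k.
     lpga_inv (take i h) \<and> queue (h ! i) = queue_after (take i h) \<and> vqueue (h ! i) = vqueue_after
         (take i h)
     \<and> sampled (h ! i) \<subseteq> {1..n}
     \<and> (\<forall>j\<in>{1..n}. next_queue (h ! i) j = 0 \<longrightarrow> set_pmf (xi j) \<inter> {queue (h ! i) j + joins (h ! i)
         j..} \<noteq> {}))"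
  using assms(2)
proof (induction k arbitrary: h)
  case 0
  then show ?case by (simp add: lpga_inv_def)
next
  case (Suc k)
  then obtain h' p where h': "h' \<in> set_pmf (lpga_run x y pick k)" "p \<in> set_pmf (lpga_step x y pick
      h')"
    and h: "h = h' @ [p]"
    by auto
  note IH = Suc.IH[OF h'(1)]
  note st = lpga_step_support[OF tb _ h'(2)]
  show ?case using IH st unfolding h by (auto simp: nth_append less_Suc_eq)
qed

section \<open>Law of the virtual queues\<close>

lemma abar_bounds:
  assumes "j \<in> {1..n}" "t \<in> {1..T}"
  shows "0 \<le> abar j t q" "abar j t q \<le> 1"
  using join_prob[OF assms(1), of q] arrival_prob[OF assms(2)] by (auto simp: abar_def intro:
      mult_le_one)

lemma abar_antimono:
  assumes "j \<in> {1..n}" "t \<in> {1..T}" "q \<le> q'"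
  shows "abar j t q' \<le> abar j t q"
  using antimonoD[OF join_antimono[OF assms(1)] assms(3)] arrival_prob[OF assms(2)]
  by (auto simp: abar_def)

text \<open>The convention \<open>theta = 0\<close> at \<open>y = 0\<close> is consistent with
  \<open>y * theta = x\<close>, since \<open>x \<le> y\<close> forces \<open>x = 0\<close>
  there.\<close>

lemma theta_bounds:
  assumes "molp_feasible x y" "j \<in> {1..n}" "t \<in> {1..T}" "q \<le> t - 1"
  shows "0 \<le> theta x y j q t" "theta x y j q t \<le> 1" "y j q t * theta x y j q t = x j q t"
proof -
  have "q \<in> {0..t-1}" "t \<in> {1..T+1}" using assms by auto
  then have "0 \<le> x j q t" "x j q t \<le> y j q t" "0 \<le> y j q t"
    using assms unfolding molp_feasible_def by blast+
  then show "0 \<le> theta x y j q t" "theta x y j q t \<le> 1" "y j q t * theta x y j q t = x j q t"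
    by (auto simp: theta_def)
qed

text \<open>Domination and antitone \<open>abar\<close> make the quotient in \<open>w\<close> at
  most 1, so \<open>w\<close> inherits the bound of \<open>theta\<close>. The third claim is the
  calibration that removes the actual state from virtual joins.\<close>

lemma w_bounds:
  assumes "molp_feasible x y" "j \<in> {1..n}" "t \<in> {1..T}" "Q j \<le> Qh j" "Qh j \<le> t - 1"
  shows "0 \<le> w x y t Q Qh j" "w x y t Q Qh j \<le> 1"
    "w x y t Q Qh j * abar j t (Q j) = theta x y j (Qh j) t * abar j t (Qh j)"
proof -
  note th = theta_bounds[OF assms(1-3) assms(5)]
  note ab = abar_bounds[OF assms(2,3)]
  note le = abar_antimono[OF assms(2-4)]
  show "0 \<le> w x y t Q Qh j" using th ab by (simp add: w_def)
  have "theta x y j (Qh j) t * abar j t (Qh j) \<le> 1 * abar j t (Q j)"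
    using th ab le by (intro mult_mono) auto
  then show "w x y t Q Qh j \<le> 1" using ab by (simp add: w_def)
  \<comment> \<open>If \<open>abar\<close> vanishes at the actual state, it vanishes at the longer
    virtual queue too, and both sides are 0.\<close>
  show "w x y t Q Qh j * abar j t (Q j) = theta x y j (Qh j) t * abar j t (Qh j)"
    using ab[of "Q j"] ab[of "Qh j"] le by (auto simp: w_def)
qed

text \<open>The selected service joins with probability \<open>lam t * a\<close>, exactly as the others do virtually.\<close>

lemma vjoin_law:
  assumes tb: "tie_breaking pick" and t: "t \<in> {1..T}"
  shows "bernoulli_pmf (lam t) \<bind> (\<lambda>arr. join_pmf Q (if arr then lpga_selected pick t Q I else None)
      \<bind> (\<lambda>A. vjoin_pmf t Q I (lpga_selected pick t Q I) A))
    = Pi_pmf {1..n} 0 (\<lambda>k. if I k then map_pmf of_bool (bernoulli_pmf (abar k t (Q k))) else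
        return_pmf 0)"
proof (cases "lpga_selected pick t Q I")
  case None
  then have "\<not> I k" if "k \<in> {1..n}" for k
    using that by (auto simp: lpga_selected_def Let_def split: if_splits)
  then show ?thesis using None by (auto simp: vjoin_pmf_def join_pmf_def intro!: Pi_pmf_cong)
next
  case (Some m)
  note m = lpga_selected_SomeD[OF tb Some]
  let ?G = "\<lambda>k. if I k then map_pmf of_bool (bernoulli_pmf (abar k t (Q k))) else return_pmf
      (0::nat)"
  let ?X = "bernoulli_pmf (lam t) \<bind> (\<lambda>arr. if arr then bernoulli_pmf (a m (Q m)) else return_pmf
      False)"
  have X: "?X = bernoulli_pmf (abar m t (Q m))"
    unfolding abar_def by (rule bernoulli_thin) (use join_prob[OF m(1), of "Q m"] arrival_prob[OF
        t] in auto)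
  define P where "P v = Pi_pmf {1..n} 0 (\<lambda>k. if k = m then return_pmf v else ?G k)" for v
  \<comment> \<open>Only the selected coordinate of \<open>A\<close> is ever read.\<close>
  have v: "vjoin_pmf t Q I (Some m) = (\<lambda>A. P (A m))"
    unfolding vjoin_pmf_def P_def by (intro ext Pi_pmf_cong) auto
  have "bernoulli_pmf (lam t) \<bind> (\<lambda>arr. join_pmf Q (if arr then Some m else None) \<bind> vjoin_pmf t Q I
      (Some m))
      = map_pmf of_bool ?X \<bind> P"
    unfolding v
    by (auto simp: join_pmf_def bind_map_pmf map_bind_pmf bind_assoc_pmf bind_return_pmf intro!:
        bind_pmf_cong)
  also have "\<dots> = Pi_pmf {1..n} 0 (\<lambda>k. if k = m then map_pmf of_bool ?X else ?G k)"
    unfolding P_def by (rule Pi_pmf_bind_component) (use m in auto)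
  also have "\<dots> = Pi_pmf {1..n} 0 ?G"
    by (rule Pi_pmf_cong) (use m X in auto)
  finally show ?thesis unfolding Some .
qed

text \<open>The transition kernel behind the LP flow constraint, with recommendation probability
  \<open>theta\<close>; it sees only the virtual state of one service.\<close>

definition vstep :: "(nat \<Rightarrow> nat \<Rightarrow> nat \<Rightarrow> real) \<Rightarrow> (nat \<Rightarrow> nat \<Rightarrow> nat \<Rightarrow> real)
    \<Rightarrow> nat \<Rightarrow> nat \<Rightarrow> nat \<Rightarrow> nat pmf" where
  "vstep x y j t q = bernoulli_pmf (theta x y j q t * abar j t q) \<bind> (\<lambda>b. map_pmf (\<lambda>B. q + of_bool
      b - B) (xi j))"

text \<open>Conditionally on the history, the actual queues cancel twice: in the capacities by
  resampling, and in the joins by the calibration of \<open>w\<close>. What remains is a product law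
  depending on \<open>h\<close> only through its virtual queues and its length.\<close>

lemma next_vqueue_law:
  assumes tb: "tie_breaking pick" and feas: "molp_feasible x y" and inv: "lpga_inv h" and t:
      "length h < T"
  shows "map_pmf next_vqueue (lpga_step x y pick h)
    = Pi_pmf {1..n} 0 (\<lambda>j. vstep x y j (Suc (length h)) (vqueue_after h j))"
proof -
  let ?t = "Suc (length h)" and ?Q = "queue_after h" and ?Qh = "vqueue_after h"
  let ?w = "w x y ?t ?Q ?Qh" and ?J = "lpga_selected pick ?t ?Q"
  let ?W = "Pi_pmf {1..n} False (\<lambda>j. bernoulli_pmf (?w j))"
  let ?F = "\<lambda>Ah. Pi_pmf {1..n} 0 xi \<bind> (\<lambda>Bh. return_pmf (\<lambda>j. ?Qh j + Ah j - Bh j))"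
  have tT: "?t \<in> {1..T}" using t by auto
  have inv': "?Q j \<le> ?Qh j" "?Qh j \<le> ?t - 1" if "j \<in> {1..n}" for j
    using inv that by (auto simp: lpga_inv_def)
  have wb: "0 \<le> ?w k" "?w k \<le> 1" "?w k * abar k ?t (?Q k) = theta x y k (?Qh k) ?t * abar k ?t
      (?Qh k)"
    if "k \<in> {1..n}" for k
    using w_bounds[where Q="?Q" and Qh="?Qh", OF feas that tT inv'[OF that]] by auto
  have "map_pmf next_vqueue (lpga_step x y pick h)
    = ?W \<bind> (\<lambda>I. bernoulli_pmf (lam ?t) \<bind> (\<lambda>arr. join_pmf ?Q (if arr then ?J I else None)
      \<bind> (\<lambda>A. serve_pmf (\<lambda>j. ?Q j + A j) \<bind> (\<lambda>Q'. vjoin_pmf ?t ?Q I (?J I) A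
      \<bind> (\<lambda>Ah. Pi_pmf {1..n} 0 (\<lambda>j. bhat_pmf j (?Q j + A j) (Q' j))
      \<bind> (\<lambda>Bh. return_pmf (\<lambda>j. ?Qh j + Ah j - Bh j)))))))"
    unfolding lpga_step_alt Suc_eq_plus1[symmetric] by (simp add: map_bind_pmf)
  \<comment> \<open>Given \<open>A\<close>, service and virtual joins are drawn independently, so
    their order may be swapped; service followed by resampling then collapses by
    \<open>serve_bhat\<close>.\<close>
  also have "\<dots> = ?W \<bind> (\<lambda>I. bernoulli_pmf (lam ?t) \<bind> (\<lambda>arr. join_pmf ?Q (if arr then ?J I else None)
      \<bind> (\<lambda>A. vjoin_pmf ?t ?Q I (?J I) A \<bind> ?F)))"
  proof -
    have "serve_pmf (\<lambda>j. ?Q j + A j) \<bind> (\<lambda>Q'. vjoin_pmf ?t ?Q I (?J I) A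
      \<bind> (\<lambda>Ah. Pi_pmf {1..n} 0 (\<lambda>j. bhat_pmf j (?Q j + A j) (Q' j))
      \<bind> (\<lambda>Bh. return_pmf (\<lambda>j. ?Qh j + Ah j - Bh j))))
      = vjoin_pmf ?t ?Q I (?J I) A \<bind> ?F" for A I
      by (subst bind_commute_pmf, subst serve_bhat[of "\<lambda>j. ?Q j + A j", symmetric]) (simp add:
          bind_assoc_pmf)
    then show ?thesis by simp
  qed
  also have "\<dots> = (?W \<bind> (\<lambda>I. bernoulli_pmf (lam ?t) \<bind> (\<lambda>arr. join_pmf ?Q (if arr then ?J I else None)
      \<bind> (\<lambda>A. vjoin_pmf ?t ?Q I (?J I) A)))) \<bind> ?F"
    by (simp add: bind_assoc_pmf)
  also have "?W \<bind> (\<lambda>I. bernoulli_pmf (lam ?t) \<bind> (\<lambda>arr. join_pmf ?Q (if arr then ?J I else None)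
      \<bind> (\<lambda>A. vjoin_pmf ?t ?Q I (?J I) A)))
    = Pi_pmf {1..n} 0 (\<lambda>k. bernoulli_pmf (?w k) \<bind>
        (\<lambda>i. if i then map_pmf of_bool (bernoulli_pmf (abar k ?t (?Q k))) else return_pmf 0))"
    by (simp only: vjoin_law[OF tb tT] Pi_pmf_bind[where d'=False, OF finite_atLeastAtMost])
  also have "\<dots> = Pi_pmf {1..n} 0 (\<lambda>k. map_pmf of_bool (bernoulli_pmf (theta x y k (?Qh k) ?t *
      abar k ?t (?Qh k))))"
  proof (rule Pi_pmf_cong[OF refl refl])
    fix k assume k: "k \<in> {1..n}"
    have "bernoulli_pmf (?w k) \<bind> (\<lambda>i. if i then map_pmf of_bool (bernoulli_pmf (abar k ?t (?Q k)))
        else return_pmf (0::nat))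
       = map_pmf of_bool (bernoulli_pmf (?w k) \<bind> (\<lambda>i. if i then bernoulli_pmf (abar k ?t (?Q k))
           else return_pmf False))"
      unfolding map_bind_if map_return_pmf of_bool_eq ..
    \<comment> \<open>The actual queue is about to drop out: this parameter equals
      \<open>theta * abar\<close> at the virtual state.\<close>
    also have "\<dots> = map_pmf of_bool (bernoulli_pmf (?w k * abar k ?t (?Q k)))"
      by (subst bernoulli_thin) (use wb[OF k] abar_bounds[OF k tT] in auto)
    finally show "bernoulli_pmf (?w k) \<bind> (\<lambda>i. if i then map_pmf of_bool (bernoulli_pmf (abar k ?t
        (?Q k))) else return_pmf (0::nat))
      = map_pmf of_bool (bernoulli_pmf (theta x y k (?Qh k) ?t * abar k ?t (?Qh k)))"
      using wb(3)[OF k] by simp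
  qed
  also have "\<dots> \<bind> ?F = \<dots> \<bind> (\<lambda>Ah. Pi_pmf {1..n} 0 (\<lambda>j. map_pmf (\<lambda>B. ?Qh j + Ah j - B) (xi j)))"
  proof (rule bind_pmf_cong[OF refl])
    fix Ah :: "nat \<Rightarrow> nat"
    assume Ah: "Ah \<in> set_pmf (Pi_pmf {1..n} 0 (\<lambda>k. map_pmf of_bool (bernoulli_pmf (theta x y k
        (?Qh k) ?t * abar k ?t (?Qh k)))))"
    \<comment> \<open>Off the services the invariant gives virtual length 0, in agreement with the
      default of the product.\<close>
    have "?Qh j + Ah j - B j = (if j \<in> {1..n} then ?Qh j + Ah j - B j else 0)" for j and B :: "nat
        \<Rightarrow> nat"
      using inv Pi_pmf_memD(2)[OF Ah, of j] by (auto simp: lpga_inv_def)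
    then have "?F Ah = map_pmf (\<lambda>B j. if j \<in> {1..n} then ?Qh j + Ah j - B j else 0) (Pi_pmf {1..n}
        0 xi)"
      by (simp add: map_pmf_def)
    then show "?F Ah = Pi_pmf {1..n} 0 (\<lambda>j. map_pmf (\<lambda>B. ?Qh j + Ah j - B) (xi j))"
      by (rule trans) (rule map_Pi_pmf[where g="\<lambda>j B. ?Qh j + Ah j - B", OF finite_atLeastAtMost])
  qed
  also have "\<dots> = Pi_pmf {1..n} 0 (\<lambda>j. map_pmf of_bool (bernoulli_pmf (theta x y j (?Qh j) ?t *
      abar j ?t (?Qh j)))
       \<bind> (\<lambda>v. map_pmf (\<lambda>B. ?Qh j + v - B) (xi j)))"
    by (simp only: Pi_pmf_bind[where d'=0, OF finite_atLeastAtMost])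
  finally show ?thesis by (simp add: vstep_def bind_map_pmf)
qed

primrec vlaw :: "(nat \<Rightarrow> nat \<Rightarrow> nat \<Rightarrow> real) \<Rightarrow> (nat \<Rightarrow> nat \<Rightarrow> nat \<Rightarrow> real) \<Rightarrow> nat \<Rightarrow> nat \<Rightarrow> nat pmf" where
  "vlaw x y j 0 = return_pmf 0"
| "vlaw x y j (Suc k) = vlaw x y j k \<bind> vstep x y j (Suc k)"

text \<open>The conditional law of a step is a product of kernels, each acting on its own
  coordinate, so independence across services propagates through time.\<close>

lemma vqueue_law:
  assumes tb: "tie_breaking pick" and feas: "molp_feasible x y"
  shows "k \<le> T \<Longrightarrow> map_pmf vqueue_after (lpga_run x y pick k) = Pi_pmf {1..n} 0 (\<lambda>j. vlaw x y j k)"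
proof (induction k)
  case 0
  then show ?case by simp
next
  case (Suc k)
  have "map_pmf vqueue_after (lpga_run x y pick (Suc k))
      = lpga_run x y pick k \<bind> (\<lambda>h. map_pmf next_vqueue (lpga_step x y pick h))"
    by (simp add: map_bind_pmf) (simp add: map_pmf_def)
  also have "\<dots> = lpga_run x y pick k \<bind> (\<lambda>h. Pi_pmf {1..n} 0 (\<lambda>j. vstep x y j (Suc k) (vqueue_after
      h j)))"
  proof (rule bind_pmf_cong[OF refl])
    fix h assume "h \<in> set_pmf (lpga_run x y pick k)"
    then have "length h = k" "lpga_inv h" using lpga_run_support[OF tb] by blast+
    then show "map_pmf next_vqueue (lpga_step x y pick h) = Pi_pmf {1..n} 0 (\<lambda>j. vstep x y j (Suc
        k) (vqueue_after h j))"
      using next_vqueue_law[OF tb feas] Suc.prems by auto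
  qed
  also have "\<dots> = map_pmf vqueue_after (lpga_run x y pick k) \<bind> (\<lambda>Qh. Pi_pmf {1..n} 0 (\<lambda>j. vstep x y
      j (Suc k) (Qh j)))"
    by (simp add: bind_map_pmf)
  also have "\<dots> = Pi_pmf {1..n} 0 (\<lambda>j. vlaw x y j (Suc k))"
    using Suc by (simp add: Pi_pmf_bind[where d'=0])
  finally show ?case .
qed

text \<open>Multiplying the kernel by \<open>y\<close> and using \<open>y * theta = x\<close> turns
  the recursion of the chain into the flow constraint. After \<open>k\<close> periods the chain is
  at the start of period \<open>Suc k\<close>.\<close>

lemma vlaw_pmf:
  assumes feas: "molp_feasible x y" and j: "j \<in> {1..n}"
  shows "k \<le> T \<Longrightarrow> set_pmf (vlaw x y j k) \<subseteq> {0..k} \<and> (\<forall>q\<in>{0..k}. pmf (vlaw x y j k) q = y j q (Suc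
      k))"
proof (induction k)
  case 0
  have "y j 0 1 = 1" using feas j unfolding molp_feasible_def by blast
  then show ?case by simp
next
  case (Suc k)
  let ?t = "Suc k"
  have tT: "?t \<in> {1..T}" using Suc.prems by auto
  from Suc have IH: "set_pmf (vlaw x y j k) \<subseteq> {0..k}" "\<And>q. q \<in> {0..k} \<Longrightarrow> pmf (vlaw x y j k) q = y j
      q ?t"
    by auto
  have "q' \<le> Suc k" if q': "q' \<in> set_pmf (vlaw x y j (Suc k))" for q'
  proof -
    obtain q where q: "q \<in> set_pmf (vlaw x y j k)" "q' \<in> set_pmf (vstep x y j (Suc k) q)"
      using q' by auto
    then have "q' \<le> q + 1" by (auto simp: vstep_def of_bool_def split: if_splits)
    then show ?thesis using q(1) IH(1) by fastforce
  qed
  moreover have "pmf (vlaw x y j (Suc k)) q' = y j q' (Suc ?t)" if q': "q' \<in> {0..?t}" for q'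
  proof -
    have "pmf (vlaw x y j (Suc k)) q' = (\<Sum>q=0..k. pmf (vstep x y j ?t q) q' * pmf (vlaw x y j k) q)"
      by (simp add: pmf_bind, rule integral_measure_pmf_real) (use IH(1) in auto)
    also have "\<dots> = (\<Sum>q=0..?t-1. (y j q ?t - abar j ?t q * x j q ?t) * K j q q'
                     + abar j ?t q * x j q ?t * K j (q+1) q')"
    proof (rule sum.cong)
      fix q assume q: "q \<in> {0..?t-1}"
      then have q': "q \<le> ?t - 1" "q \<in> {0..k}" by auto
      note th = theta_bounds[OF feas j tT q'(1)]
      note ab = abar_bounds[OF j tT, of q]
      have p: "0 \<le> theta x y j q ?t * abar j ?t q" "theta x y j q ?t * abar j ?t q \<le> 1"
        using th ab by (auto intro: mult_le_one)
      have K: "pmf (map_pmf (\<lambda>B. c - B) (xi j)) q' = K j c q'" for c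
        by (simp add: pmf_map K_def vimage_def)
      have P: "pmf (vstep x y j ?t q) q' = theta x y j q ?t * abar j ?t q * K j (q + 1) q'
          + (1 - theta x y j q ?t * abar j ?t q) * K j q q'"
        unfolding vstep_def using p K[of "q + 1"] K[of q] by (simp add: pmf_bind)
      show "pmf (vstep x y j ?t q) q' * pmf (vlaw x y j k) q = (y j q ?t - abar j ?t q * x j q ?t)
          * K j q q'
                     + abar j ?t q * x j q ?t * K j (q+1) q'"
        unfolding IH(2)[OF q'(2)] th(3)[symmetric] P by (simp add: algebra_simps)
    qed simp
    also have "\<dots> = y j q' (?t + 1)"
      using feas j tT q' unfolding molp_feasible_def by fastforce
    finally show ?thesis by simp
  qed
  ultimately show ?case by (auto simp del: vlaw.simps)
qed

lemma lpga_is_well_defined: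
  assumes tb: "tie_breaking pick" and feas: "molp_feasible x y"
  shows "lpga_well_defined x y pick"
  unfolding lpga_well_defined_def AE_measure_pmf_iff
proof (intro ballI)
  fix h t j assume h: "h \<in> set_pmf (lpga_run x y pick T)" and t: "t \<in> {1..T}" and j: "j \<in> {1..n}"
  let ?p = "h ! (t - 1)" and ?g = "take (t - 1) h"
  have "t - 1 < T" using t by auto
  with lpga_run_support[OF tb h] have *: "length h = T" "lpga_inv ?g" "queue ?p = queue_after ?g"
    "vqueue ?p = vqueue_after ?g" "sampled ?p \<subseteq> {1..n}"
    "next_queue ?p j = 0 \<Longrightarrow> set_pmf (xi j) \<inter> {queue ?p j + joins ?p j..} \<noteq> {}" using j by blast+
  have "length ?g = t - 1" using *(1) t by auto
  then have le: "queue ?p j \<le> vqueue ?p j" "vqueue ?p j \<le> t - 1"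
    using *(2) j unfolding *(3,4) lpga_inv_def by auto
  have "finite (sampled ?p)" using *(5) finite_subset by blast
  then show "let p = h ! (t - 1); q = queue p j; qp = q + joins p j in
        0 \<le> w x y t (queue p) (vqueue p) j \<and> w x y t (queue p) (vqueue p) j \<le> 1 \<and>
        0 \<le> a j q \<and> a j q \<le> 1 \<and>
        0 \<le> abar j t q \<and> abar j t q \<le> 1 \<and>
        (next_queue p j = 0 \<longrightarrow>
           0 < measure_pmf.prob (xi j) {qp..} \<and>
           (\<forall>b. 0 \<le> bhat_weight j qp b) \<and> bhat_weight j qp sums 1) \<and>
        (sampled p \<noteq> {} \<longrightarrow> argmax_set t (queue p) (sampled p) \<noteq> {})"
    unfolding Let_def
    using w_bounds[where Q="queue ?p" and Qh="vqueue ?p", OF feas j t le] join_prob[OF j]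
        abar_bounds[OF j t]
      bhat_weight_valid[OF *(6)] argmax_set_nonempty by auto
qed

section \<open>Revenue of the algorithm\<close>

lemma lpga_run_revenue:
  "lpga_expected_revenue x y pick = (\<Sum>k<T. measure_pmf.expectation (lpga_run x y pick k)
      (\<lambda>h. measure_pmf.expectation (lpga_join x y pick h)
        (\<lambda>A. \<Sum>j=1..n. r j * real (A j) * kappa j (queue_after h j) (Suc k))))"
  unfolding lpga_expected_revenue_def
  by (rule run_revenue[where S="lpga_step x y pick"], simp, simp, rule lpga_step_joins, erule
      lpga_join_le)

definition gain :: "nat \<Rightarrow> nat \<Rightarrow> nat \<Rightarrow> real" where
  "gain j t q = r j * abar j t q * kappa j q t"

lemma gain_bounds:
  assumes "j \<in> {1..n}" "t \<in> {1..T}"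
  shows "0 \<le> gain j t q" "gain j t q \<le> (\<Sum>j=1..n. r j)"
proof -
  note b = abar_bounds[OF assms, of q] kappa_bounds[of j q t] revenue_nonneg[OF assms(1)]
  show "0 \<le> gain j t q" using b by (simp add: gain_def)
  have "gain j t q = r j * (abar j t q * kappa j q t)" by (simp add: gain_def)
  also have "\<dots> \<le> r j * 1" using b by (intro mult_left_mono mult_le_one) auto
  also have "r j * 1 \<le> (\<Sum>j=1..n. r j)"
    using member_le_sum[of j "{1..n}" r] assms(1) revenue_nonneg by auto
  finally show "gain j t q \<le> (\<Sum>j=1..n. r j)" .
qed

lemma abs_stage_revenue_le:
  assumes "\<And>j. A j \<le> (1 :: nat)"
  shows "\<bar>\<Sum>j=1..n. r j * real (A j) * kappa j (Q j) t\<bar> \<le> (\<Sum>j=1..n. r j)"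
proof -
  have "0 \<le> r j * real (A j) * kappa j (Q j) t \<and> r j * real (A j) * kappa j (Q j) t \<le> r j" if "j \<in>
      {1..n}" for j
  proof -
    have "A j = 0 \<or> A j = 1" using assms[of j] by auto
    then show ?thesis using revenue_nonneg[OF that] kappa_bounds[of j "Q j" t] by (auto intro:
        mult_left_le)
  qed
  then show ?thesis by (subst abs_of_nonneg) (auto intro!: sum_nonneg sum_mono)
qed

text \<open>The greedy choice attains the maximum of the offered gains, and arrival plus acceptance
  contribute exactly \<open>abar\<close>. Nonnegative gains make the floor 0 correct both with and
  without sampled services.\<close>

lemma expectation_selected:
  assumes tb: "tie_breaking pick" and t: "t \<in> {1..T}"
  shows "measure_pmf.expectation (bernoulli_pmf (lam t) \<bind> (\<lambda>arr. join_pmf Q (if arr then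
      lpga_selected pick t Q I else None)))
      (\<lambda>A. \<Sum>j=1..n. r j * real (A j) * kappa j (Q j) t)
    = bmax 0 (\<lambda>j. if I j then gain j t (Q j) else 0) {1..n}" (is "?lhs = bmax 0 ?z _")
proof -
  let ?J = "lpga_selected pick t Q I"
  have J: "?J = None \<or> ?J \<in> Some ` {1..n}" using lpga_selected_SomeD(1)[OF tb] by (cases ?J) auto
  have lam: "0 \<le> lam t" "lam t \<le> 1" using arrival_prob[OF t] by auto
  let ?M = "bernoulli_pmf (lam t) \<bind> (\<lambda>arr. join_pmf Q (if arr then ?J else None))"
  have le1: "A j \<le> 1" if "A \<in> set_pmf ?M" for A j using that join_le by auto
  have "?lhs = (\<Sum>j=1..n. r j * measure_pmf.expectation ?M (\<lambda>A. real (A j)) * kappa j (Q j) t)"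
  proof -
    have "integrable (measure_pmf ?M) (\<lambda>A. real (A j))" for j
      by (rule integrable_pmf_bounded[where C=1]) (use le1 in \<open>auto simp del: set_bind_pmf\<close>)
    then show ?thesis by (subst Bochner_Integration.integral_sum) auto
  qed
  also have "\<dots> = (\<Sum>j=1..n. if ?J = Some j then gain j t (Q j) else 0)"
  proof (rule sum.cong[OF refl])
    fix j
    have "measure_pmf.expectation ?M (\<lambda>A. real (A j))
        = measure_pmf.expectation (bernoulli_pmf (lam t)) (\<lambda>arr. of_bool (arr \<and> ?J = Some j) * a j
            (Q j))"
    proof (subst expectation_bind_pmf[where C=1])
      fix arr A assume "A \<in> set_pmf (join_pmf Q (if arr then ?J else None))"
      then show "\<bar>real (A j)\<bar> \<le> 1" using join_le by auto
    next
      show "measure_pmf.expectation (bernoulli_pmf (lam t)) (\<lambda>arr. measure_pmf.expectation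
          (join_pmf Q (if arr then ?J else None)) (\<lambda>A. real (A j)))
        = measure_pmf.expectation (bernoulli_pmf (lam t)) (\<lambda>arr. of_bool (arr \<and> ?J = Some j) * a j
            (Q j))"
        using expectation_join[OF J, of Q real j] expectation_join[of None Q real j]
        by (intro expectation_cong_pmf) auto
    qed
    also have "\<dots> = (if ?J = Some j then abar j t (Q j) else 0)" using lam by (simp add: abar_def)
    finally show "r j * measure_pmf.expectation ?M (\<lambda>A. real (A j)) * kappa j (Q j) t
      = (if ?J = Some j then gain j t (Q j) else 0)" by (simp add: gain_def)
  qed
  also have "\<dots> = bmax 0 ?z {1..n}"
  proof (cases ?J)
    case None
    then have "?z j = 0" if "j \<in> {1..n}" for j
      using that by (auto simp: lpga_selected_def Let_def split: if_splits)
    then have "bmax 0 ?z {1..n} \<in> {0}" using bmax_in[of "{1..n}" 0 ?z] by auto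
    then show ?thesis using None by simp
  next
    case (Some m)
    note m = lpga_selected_SomeD[OF tb Some]
    have "bmax 0 ?z {1..n} = ?z m"
      unfolding bmax_def
    proof (rule Max_eqI)
      fix v assume "v \<in> insert 0 (?z ` {1..n})"
      then consider "v = 0" | j where "j \<in> {1..n}" "I j" "v = gain j t (Q j)" by auto
      then show "v \<le> ?z m"
      proof cases
        case 1
        then show ?thesis using m gain_bounds(1)[OF m(1) t, of "Q m"] by simp
      next
        case 2
        then show ?thesis using m(2,3) by (auto simp: argmax_set_def gain_def mult_ac)
      qed
    qed (use m in auto)
    then show ?thesis using Some m by simp
  qed
  finally show ?thesis .
qed

text \<open>Given the history, replacing the actual state of each service by its virtual state lowers
  the expected maximum: a smaller value is offered with a larger probability, at no larger mean.\<close>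

lemma lpga_stage_ge:
  assumes tb: "tie_breaking pick" and feas: "molp_feasible x y" and inv: "lpga_inv h" and h:
      "length h = k" "k < T"
  shows "measure_pmf.expectation (Pi_pmf {1..n} 0 (\<lambda>j. on_off (theta x y j (vqueue_after h j) (Suc
      k)) (gain j (Suc k) (vqueue_after h j))))
        (\<lambda>z. bmax 0 z {1..n})
    \<le> measure_pmf.expectation (lpga_join x y pick h) (\<lambda>A. \<Sum>j=1..n. r j * real (A j) * kappa j
        (queue_after h j) (Suc k))"
proof -
  let ?t = "Suc k" and ?Q = "queue_after h" and ?Qh = "vqueue_after h"
  let ?w = "w x y ?t ?Q ?Qh"
  let ?W = "Pi_pmf {1..n} False (\<lambda>j. bernoulli_pmf (?w j))"
  define C where "C = (\<Sum>j=1..n. r j)"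
  have tT: "?t \<in> {1..T}" using h by auto
  have inv': "?Q j \<le> ?Qh j" "?Qh j \<le> ?t - 1" if "j \<in> {1..n}" for j
    using inv h that by (auto simp: lpga_inv_def)
  have C0: "0 \<le> C" unfolding C_def using revenue_nonneg by (intro sum_nonneg) auto
  have mono: "measure_pmf.expectation (on_off (theta x y j (?Qh j) ?t) (gain j ?t (?Qh j))) (\<lambda>v.
      max m v)
      \<le> measure_pmf.expectation (on_off (?w j) (gain j ?t (?Q j))) (\<lambda>v. max m v)"
    if j: "j \<in> {1..n}" and m: "0 \<le> m" for j m
  proof -
    let ?th = "theta x y j (?Qh j) ?t" and ?u = "gain j ?t (?Qh j)" and ?v = "gain j ?t (?Q j)"
    note wb = w_bounds[where Q="?Q" and Qh="?Qh", OF feas j tT inv'[OF j]]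
    note th = theta_bounds[OF feas j tT inv'(2)[OF j]]
    note ab = abar_bounds[OF j tT] and am = abar_antimono[OF j tT inv'(1)[OF j]]
    \<comment> \<open>By the calibration of \<open>w\<close> the two means differ only in
      \<open>kappa\<close>, which is no smaller at the shorter actual queue.\<close>
    have "?th * ?u = r j * kappa j (?Qh j) ?t * (?w j * abar j ?t (?Q j))"
      unfolding wb(3) by (simp add: gain_def)
    also have "\<dots> \<le> r j * kappa j (?Q j) ?t * (?w j * abar j ?t (?Q j))"
      using revenue_nonneg[OF j] kappa_antimono[OF inv'(1)[OF j]] wb th(1) ab
      by (intro mult_right_mono mult_left_mono) auto
    finally have mean: "?th * ?u \<le> ?w j * ?v" by (simp add: gain_def mult_ac)
    \<comment> \<open>As \<open>max m v = m + max 0 (v - m)\<close>, only the excess over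
      \<open>m\<close> matters. If the virtual gain exceeds \<open>m\<close>, then
      \<open>w \<le> theta\<close> makes the actual offer lose no more to the subtraction of
      \<open>m\<close>, while its mean is no smaller.\<close>
    have "?th * max 0 (?u - m) \<le> ?w j * max 0 (?v - m)"
    proof (cases "?u \<le> m")
      case True
      then show ?thesis using wb by (simp add: max_def)
    next
      case False
      then have "?u > 0" using m by simp
      then have "abar j ?t (?Qh j) > 0"
        using ab[of "?Qh j"] by (cases "abar j ?t (?Qh j) = 0") (auto simp: gain_def)
      then have "?w j = ?th * (abar j ?t (?Qh j) / abar j ?t (?Q j))"
        "abar j ?t (?Qh j) / abar j ?t (?Q j) \<le> 1"
        using am by (auto simp: w_def)
      then have "?w j \<le> ?th" using mult_left_mono[of _ 1 ?th] th(1) by fastforce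
      then have "?w j * m \<le> ?th * m" using m by (rule mult_right_mono)
      with mean have "?th * (?u - m) \<le> ?w j * (?v - m)" by (simp add: algebra_simps)
      also have "\<dots> \<le> ?w j * max 0 (?v - m)" using wb(1) by (intro mult_left_mono) auto
      finally show ?thesis using False by simp
    qed
    moreover have "max m v = m + max 0 (v - m)" for v :: real by (simp add: max_def)
    ultimately show ?thesis
      using wb(1,2) th(1,2) m by (simp add: expectation_on_off algebra_simps)
  qed
  have "measure_pmf.expectation (Pi_pmf {1..n} 0 (\<lambda>j. on_off (theta x y j (?Qh j) ?t) (gain j ?t
      (?Qh j)))) (\<lambda>z. bmax 0 z {1..n})
    \<le> measure_pmf.expectation (Pi_pmf {1..n} 0 (\<lambda>j. on_off (?w j) (gain j ?t (?Q j)))) (\<lambda>z. bmax 0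
        z {1..n})"
  proof (rule expectation_bmax_mono[where C=C])
    fix j z assume j: "j \<in> {1..n}"
    note g = gain_bounds(2)[OF j tT, folded C_def]
    show "z \<in> set_pmf (on_off (?w j) (gain j ?t (?Q j))) \<Longrightarrow> z \<le> C"
      "z \<in> set_pmf (on_off (theta x y j (?Qh j) ?t) (gain j ?t (?Qh j))) \<Longrightarrow> z \<le> C"
      using set_on_off g C0 by fastforce+
  qed (use mono in auto)
  also have "Pi_pmf {1..n} 0 (\<lambda>j. on_off (?w j) (gain j ?t (?Q j)))
     = map_pmf (\<lambda>I j. if j \<in> {1..n} then (if I j then gain j ?t (?Q j) else 0) else 0) ?W"
    unfolding on_off_def
    by (rule map_Pi_pmf[where g="\<lambda>j b. if b then gain j ?t (?Q j) else 0", symmetric]) simp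
  also have "measure_pmf.expectation \<dots> (\<lambda>z. bmax 0 z {1..n})
     = measure_pmf.expectation ?W (\<lambda>I. bmax 0 (\<lambda>j. if I j then gain j ?t (?Q j) else 0) {1..n})"
    by (simp, intro expectation_cong_pmf bmax_cong) simp
  also have "\<dots> = measure_pmf.expectation ?W (\<lambda>I. measure_pmf.expectation
      (bernoulli_pmf (lam ?t) \<bind> (\<lambda>arr. join_pmf ?Q (if arr then lpga_selected pick ?t ?Q I else
          None)))
      (\<lambda>A. \<Sum>j=1..n. r j * real (A j) * kappa j (?Q j) ?t))"
    by (simp only: expectation_selected[OF tb tT])
  also have "\<dots> = measure_pmf.expectation (lpga_join x y pick h) (\<lambda>A. \<Sum>j=1..n. r j * real (A j) *
      kappa j (?Q j) ?t)"
  proof -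
    note abs_stage_revenue_le[where Q="?Q" and t="?t", folded C_def]
    then show ?thesis unfolding lpga_join_def h(1) Suc_eq_plus1[symmetric]
      by (subst (2) expectation_bind_pmf[where C=C]) (use join_le in auto)
  qed
  finally show ?thesis .
qed

text \<open>Drawing independent states and then independent offers amounts to drawing independent
  mixtures \<open>?p j\<close>. By \<open>y * theta = x\<close>, a mixture is positive with
  probability at most the sum of its \<open>x\<close>, so the LP limit on recommendations per period
  supplies the hypothesis of \<open>expectation_bmax_ge\<close>.\<close>

lemma virtual_stage_ge:
  assumes feas: "molp_feasible x y" and k: "k < T"
  shows "measure_pmf.expectation (Pi_pmf {1..n} 0 (\<lambda>j. vlaw x y j k))
      (\<lambda>q. measure_pmf.expectation (Pi_pmf {1..n} 0 (\<lambda>j. on_off (theta x y j (q j) (Suc k)) (gain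
          j (Suc k) (q j))))
        (\<lambda>z. bmax 0 z {1..n}))
    \<ge> (1 - 1 / exp 1) * (\<Sum>j=1..n. \<Sum>q=0..k. r j * kappa j q (Suc k) * abar j (Suc k) q * x j q (Suc
        k))"
proof -
  let ?t = "Suc k"
  define C where "C = (\<Sum>j=1..n. r j)"
  have C0: "0 \<le> C" unfolding C_def using revenue_nonneg by (intro sum_nonneg) auto
  have tT: "?t \<in> {1..T}" using k by auto
  let ?z = "\<lambda>j q. on_off (theta x y j q ?t) (gain j ?t q)"
  let ?p = "\<lambda>j. vlaw x y j k \<bind> ?z j"
  note g = gain_bounds[OF _ tT, folded C_def]
  have vl: "set_pmf (vlaw x y j k) \<subseteq> {0..k}" "\<And>q. q \<in> {0..k} \<Longrightarrow> pmf (vlaw x y j k) q = y j q ?t"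
    if "j \<in> {1..n}" for j
    using vlaw_pmf[OF feas that, of k] k by auto
  have zb: "0 \<le> z \<and> z \<le> C" if "j \<in> {1..n}" "z \<in> set_pmf (?z j q)" for j q z
    using g[OF that(1), of q] that(2) set_on_off C0 by fastforce
  \<comment> \<open>General \<open>f\<close>, since the identity is applied to the offer probability
    and to the mean; \<open>f 0 = 0\<close> makes the branch without an offer vanish.\<close>
  have mean: "measure_pmf.expectation (?p j) f = (\<Sum>q=0..k. x j q ?t * f (gain j ?t q))"
    if j: "j \<in> {1..n}" and f: "f 0 = 0" "\<And>z. 0 \<le> z \<Longrightarrow> z \<le> C \<Longrightarrow> \<bar>f z\<bar> \<le> D" for j D and f :: "real \<Rightarrow>
        real"
  proof -
    have "measure_pmf.expectation (?p j) f = measure_pmf.expectation (vlaw x y j k) (\<lambda>q.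
        measure_pmf.expectation (?z j q) f)"
      by (rule expectation_bind_pmf[where C=D]) (use zb[OF j] f(2) in blast)
    also have "\<dots> = (\<Sum>q=0..k. measure_pmf.expectation (?z j q) f * pmf (vlaw x y j k) q)"
      by (rule integral_measure_pmf_real) (use vl(1)[OF j] in auto)
    also have "\<dots> = (\<Sum>q=0..k. x j q ?t * f (gain j ?t q))"
    proof (rule sum.cong[OF refl])
      fix q assume q: "q \<in> {0..k}"
      then have "q \<le> ?t - 1" by simp
      note th = theta_bounds[OF feas j tT this]
      show "measure_pmf.expectation (?z j q) f * pmf (vlaw x y j k) q = x j q ?t * f (gain j ?t q)"
        unfolding vl(2)[OF j q] th(3)[symmetric] expectation_on_off[OF th(1,2)] f(1) by simp
    qed
    finally show ?thesis .
  qed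
  have "measure_pmf.expectation (Pi_pmf {1..n} 0 (\<lambda>j. vlaw x y j k))
      (\<lambda>q. measure_pmf.expectation (Pi_pmf {1..n} 0 (\<lambda>j. ?z j (q j))) (\<lambda>z. bmax 0 z {1..n}))
    = measure_pmf.expectation (Pi_pmf {1..n} 0 ?p) (\<lambda>z. bmax 0 z {1..n})"
  proof -
    have "\<bar>bmax 0 z {1..n}\<bar> \<le> C" if "z \<in> set_pmf (Pi_pmf {1..n} 0 (\<lambda>j. ?z j (q j)))" for q z
    proof -
      have "z j \<le> C" if j: "j \<in> {1..n}" for j
        using zb[OF j] Pi_pmf_memD(1)[OF \<open>z \<in> _\<close> finite_atLeastAtMost j] by blast
      from bmax_bounds[where z=z, OF finite_atLeastAtMost order_refl C0 this] show ?thesis by simp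
    qed
    then show ?thesis
      by (subst Pi_pmf_bind[where d'=0, OF finite_atLeastAtMost], subst expectation_bind_pmf[where
          C=C]) auto
  qed
  also have "\<dots> \<ge> (1 - 1 / exp 1) * (\<Sum>j=1..n. measure_pmf.expectation (?p j) (\<lambda>v. v))"
  proof (rule expectation_bmax_ge)
    fix j assume j: "j \<in> {1..n}"
    show "finite (set_pmf (?p j))"
      using finite_subset[OF vl(1)[OF j]] finite_subset[OF set_on_off] by auto
    show "0 \<le> z" if "z \<in> set_pmf (?p j)" for z using that zb[OF j] by auto
  next
    have "measure_pmf.prob (?p j) {0<..} \<le> (\<Sum>q=0..k. x j q ?t)" if j: "j \<in> {1..n}" for j
    proof -
      have "measure_pmf.prob (?p j) {0<..} = measure_pmf.expectation (?p j) (\<lambda>v. of_bool (0 < v))"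
        by (simp only: expectation_pmf_of_bool greaterThan_def)
      also have "\<dots> = (\<Sum>q=0..k. x j q ?t * of_bool (0 < gain j ?t q))"
        by (rule mean[OF j, of "\<lambda>v. of_bool (0 < v)" 1]) auto
      also have "\<dots> \<le> (\<Sum>q=0..k. x j q ?t)"
      proof (rule sum_mono)
        fix q assume "q \<in> {0..k}"
        then have "q \<in> {0..?t-1}" by simp
        then have "0 \<le> x j q ?t" using feas j tT unfolding molp_feasible_def by blast
        then show "x j q ?t * of_bool (0 < gain j ?t q) \<le> x j q ?t" by (simp add: of_bool_def)
      qed
      finally show ?thesis .
    qed
    then have "(\<Sum>j=1..n. measure_pmf.prob (?p j) {0<..}) \<le> (\<Sum>j=1..n. \<Sum>q=0..?t-1. x j q ?t)"
      by (intro sum_mono) simp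
    also have "\<dots> \<le> 1" using feas tT unfolding molp_feasible_def by blast
    finally show "(\<Sum>j=1..n. measure_pmf.prob (?p j) {0<..}) \<le> 1" .
  qed simp
  also have "(\<Sum>j=1..n. measure_pmf.expectation (?p j) (\<lambda>v. v))
      = (\<Sum>j=1..n. \<Sum>q=0..k. r j * kappa j q ?t * abar j ?t q * x j q ?t)"
  proof (rule sum.cong[OF refl])
    fix j assume "j \<in> {1..n}"
    from mean[OF this, of "\<lambda>v. v" C] show "measure_pmf.expectation (?p j) (\<lambda>v. v)
      = (\<Sum>q=0..k. r j * kappa j q ?t * abar j ?t q * x j q ?t)" by (simp add: gain_def mult_ac)
  qed
  finally show ?thesis .
qed

text \<open>The lower bound of \<open>lpga_stage_ge\<close> involves the virtual queues alone, so
  averaging over histories needs only their law and never that of the actual queues.\<close>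

lemma molp_objective_le_lpga:
  assumes tb: "tie_breaking pick" and feas: "molp_feasible x y"
  shows "(1 - 1 / exp 1) * molp_objective x \<le> lpga_expected_revenue x y pick"
proof -
  define C where "C = (\<Sum>j=1..n. r j)"
  have C0: "0 \<le> C" unfolding C_def using revenue_nonneg by (intro sum_nonneg) auto
  let ?v = "\<lambda>k q. measure_pmf.expectation (Pi_pmf {1..n} 0 (\<lambda>j. on_off (theta x y j (q j) (Suc k))
      (gain j (Suc k) (q j))))
        (\<lambda>z. bmax 0 z {1..n})"
  let ?a = "\<lambda>k h. measure_pmf.expectation (lpga_join x y pick h)
        (\<lambda>A. \<Sum>j=1..n. r j * real (A j) * kappa j (queue_after h j) (Suc k))"
  have stage: "(1 - 1 / exp 1) * (\<Sum>j=1..n. \<Sum>q=0..k. r j * kappa j q (Suc k) * abar j (Suc k) q * x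
      j q (Suc k))
     \<le> measure_pmf.expectation (lpga_run x y pick k) (?a k)" if k: "k < T" for k
  proof -
    have tT: "Suc k \<in> {1..T}" using k by auto
    have "(1 - 1 / exp 1) * (\<Sum>j=1..n. \<Sum>q=0..k. r j * kappa j q (Suc k) * abar j (Suc k) q * x j q
        (Suc k))
      \<le> measure_pmf.expectation (map_pmf vqueue_after (lpga_run x y pick k)) (?v k)"
      using virtual_stage_ge[OF feas k] k by (subst vqueue_law[OF tb feas]) auto
    also have "\<dots> = measure_pmf.expectation (lpga_run x y pick k) (\<lambda>h. ?v k (vqueue_after h))" by
        simp
    also have "\<dots> \<le> measure_pmf.expectation (lpga_run x y pick k) (?a k)"
    proof (rule expectation_mono_pmf)
      fix h assume "h \<in> set_pmf (lpga_run x y pick k)"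
      then have h: "length h = k" "lpga_inv h" using lpga_run_support[OF tb] by blast+
      show "?v k (vqueue_after h) \<le> ?a k h" by (rule lpga_stage_ge[OF tb feas h(2,1) k])
      show "\<bar>?v k (vqueue_after h)\<bar> \<le> C"
      proof (rule abs_expectation_le)
        fix z assume z: "z \<in> set_pmf (Pi_pmf {1..n} 0 (\<lambda>j. on_off (theta x y j (vqueue_after h j)
            (Suc k)) (gain j (Suc k) (vqueue_after h j))))"
        have "z j \<le> C" if j: "j \<in> {1..n}" for j
          using Pi_pmf_memD(1)[OF z finite_atLeastAtMost j] set_on_off C0
            gain_bounds(2)[OF j tT, folded C_def, of "vqueue_after h j"] by fastforce
        from bmax_bounds[where z=z, OF finite_atLeastAtMost order_refl C0 this] show "\<bar>bmax 0 z
            {1..n}\<bar> \<le> C" by simp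
      qed
      show "\<bar>?a k h\<bar> \<le> C"
      proof (rule abs_expectation_le)
        fix A assume A: "A \<in> set_pmf (lpga_join x y pick h)"
        show "\<bar>\<Sum>j=1..n. r j * real (A j) * kappa j (queue_after h j) (Suc k)\<bar> \<le> C"
          unfolding C_def by (rule abs_stage_revenue_le, rule lpga_join_le[OF A])
      qed
    qed
    finally show ?thesis .
  qed
  have "molp_objective x = (\<Sum>k<T. \<Sum>j=1..n. \<Sum>q=0..k. r j * kappa j q (Suc k) * abar j (Suc k) q * x
      j q (Suc k))"
    unfolding molp_objective_def by (rule sum.reindex_bij_witness[where i=Suc and j="\<lambda>t. t - 1"])
        auto
  then have "(1 - 1 / exp 1) * molp_objective x
      = (\<Sum>k<T. (1 - 1 / exp 1) * (\<Sum>j=1..n. \<Sum>q=0..k. r j * kappa j q (Suc k) * abar j (Suc k) q * x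
          j q (Suc k)))"
    by (simp only: sum_distrib_left)
  also have "\<dots> \<le> lpga_expected_revenue x y pick"
    unfolding lpga_run_revenue by (rule sum_mono, rule stage) simp
  finally show ?thesis .
qed

end

theorem theorem2:
  fixes n T :: nat
    and r lam :: "nat \<Rightarrow> real"
    and a :: "nat \<Rightarrow> nat \<Rightarrow> real"
    and xi :: "nat \<Rightarrow> nat pmf"
    and x y :: "nat \<Rightarrow> nat \<Rightarrow> nat \<Rightarrow> real"
    and pick :: "nat set \<Rightarrow> nat"
  assumes "dsr n T r lam a"
    and "dsr.molp_optimal n T r lam a xi x y"
    and "dsr.tie_breaking n pick"
  shows "dsr.lpga_well_defined n T r lam a xi x y pick \<and>
         dsr.lpga_expected_revenue n T r lam a xi x y pick
           \<ge> (1 - 1 / exp 1) * dsr.OPT n T r lam a xi"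
proof -
  interpret dsr n T r lam a xi by (rule assms(1))
  have opt: "molp_optimal x y" and tb: "tie_breaking pick" by (fact assms)+
  then have feas: "molp_feasible x y" by (simp add: molp_optimal_def)
  have "(1 - 1 / exp 1) * OPT \<le> (1 - 1 / exp 1) * molp_objective x"
    by (intro mult_left_mono OPT_le_molp[OF opt]) simp
  also note molp_objective_le_lpga[OF tb feas]
  finally show ?thesis using lpga_is_well_defined[OF tb feas] by simp
qed

end
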